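(* Let $p$ be a prime, $g>1$ an integer, $q=p^g$, $G=GL_2(\mathbb{F}_q)$, and fix non-negative integers $k_0,\dots,k_{g-1}$. For any integers $\alpha,\beta$ with $0\le\alpha\le g-1$ and $1\le\beta\le g-1$, the operators $D_\beta^{[\alpha]}=\partial_X\otimes X^{p^{g-\beta}}+\partial_Y\otimes Y^{p^{g-\beta}}$ (acting on the tensor factors of index $\alpha$ and $\alpha+\beta$) and $D^{[\alpha]}=X^q\partial_X+Y^q\partial_Y$ (acting on the tensor factor of index $\alpha$) give $G$-intertwining operators $$D_\beta^{[\alpha]}:\ \bigotimes_iM_{k_i}^{[i]}\longrightarrow\Big(\bigotimes_{i\ne\alpha,\alpha+\beta}M_{k_i}^{[i]}\Big)\otimes M_{k_\alpha-1}^{[\alpha]}\otimes M_{k_{\alpha+\beta}+p^{g-\beta}}^{[\alpha+\beta]},$$ $$D^{[\alpha]}:\ \bigotimes_iM_{k_i}^{[i]}\longrightarrow\Big(\bigotimes_{i\ne\alpha}M_{k_i}^{[i]}\Big)\otimes M_{k_\alpha+(q-1)}^{[\alpha]},$$ where the tensor product indices run over the integers $i$ with $0\le i\le g-1$, unless otherwise specified. If $0<k_\alpha\le p-1$, then $D^{[\alpha]}$ is injective; if in addition $0\le k_{\alpha+\beta}\le p-1$, then $D_\beta^{[\alpha]}$ is injective.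
   Context: All tensor products are over $\mathbb{F}_q$. For $k\ge0$, $M_k$ is the space of homogeneous polynomials of degree $k$ in $\mathbb{F}_q[X,Y]$, with $G$ acting by $\begin{pmatrix}a&b\\c&d\end{pmatrix}X=aX+cY$, $\begin{pmatrix}a&b\\c&d\end{pmatrix}Y=bX+dY$ (extended multiplicatively); $M_{-1}=0$. $M^{[n]}$ denotes the $n$-th Frobenius twist of a $G$-module $M$: the action is precomposed with the automorphism of $G$ applying the $n$-th power of $x\mapsto x^p$ to matrix entries. Indices such as $\alpha+\beta$ are read modulo $g$ in the range $\{0,\dots,g-1\}$, and tensor products differing only in the order of their factors are identified. $\partial_X,\partial_Y$ denote partial derivatives on $\mathbb{F}_q[X,Y]$, and a polynomial also denotes the operator of multiplication by it. Thus $D_\beta^{[\alpha]}$ maps $f_1\otimes f_2\in M_{k_\alpha}^{[\alpha]}\otimes M_{k_{\alpha+\beta}}^{[\alpha+\beta]}$ to $\partial_Xf_1\otimes X^{p^{g-\beta}}f_2+\partial_Yf_1\otimes Y^{p^{g-\beta}}f_2$, and $D^{[\alpha]}$ maps $f\in M_{k_\alpha}^{[\alpha]}$ to $X^q\partial_Xf+Y^q\partial_Yf$; both are extended by the identity on the remaining tensor factors. *)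

theory Defs
  imports "HOL-Analysis.Analysis" "HOL-Computational_Algebra.Computational_Algebra"
    "HOL-Library.Poly_Mapping" "HOL-Algebra.Module"
begin

(* A vector space over the field 'a (the ring operations mult and one of the
   underlying module record are never used) together with an action of 'g. *)
record ('a, 'v, 'g) rep = "('a, 'v) module" +
  act :: "'g \<Rightarrow> 'v \<Rightarrow> 'v"

definition intertwiners ::
  "'g set \<Rightarrow> ('a, 'v, 'g) rep \<Rightarrow> ('a, 'w, 'g) rep \<Rightarrow> ('v \<Rightarrow> 'w) set" where
  "intertwiners G V W = {h \<in> carrier V \<rightarrow> carrier W.
     (\<forall>x\<in>carrier V. \<forall>y\<in>carrier V. h (x \<oplus>\<^bsub>V\<^esub> y) = h x \<oplus>\<^bsub>W\<^esub> h y) \<and>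
     (\<forall>c. \<forall>x\<in>carrier V. h (c \<odot>\<^bsub>V\<^esub> x) = c \<odot>\<^bsub>W\<^esub> h x) \<and>
     (\<forall>\<gamma>\<in>G. \<forall>x\<in>carrier V. h (act V \<gamma> x) = act W \<gamma> (h x))}"

definition GL2 :: "('a::field ^ 2 ^ 2) set" where
  "GL2 = {\<gamma>. invertible \<gamma>}"

(* The tensor product of a family M over I is the quotient of the free vector space
   on the set PiE I (\<lambda>i. carrier (M i)) of choice functions by the span of the
   multilinearity relations.  Its elements are the cosets, as sets of formal linear
   combinations. *)

definition free_scale :: "'a::field \<Rightarrow> ('s \<Rightarrow>\<^sub>0 'a) \<Rightarrow> ('s \<Rightarrow>\<^sub>0 'a)" where
  "free_scale c = Poly_Mapping.map ((*) c)"

definition free_space :: "'s set \<Rightarrow> ('s \<Rightarrow>\<^sub>0 'a::field) set" where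
  "free_space S = {x. Poly_Mapping.keys x \<subseteq> S}"

definition tensor_relations ::
  "'i set \<Rightarrow> ('i \<Rightarrow> ('a::field, 'v, 'g) rep) \<Rightarrow> (('i \<Rightarrow> 'v) \<Rightarrow>\<^sub>0 'a) set" where
  "tensor_relations I M = module.span free_scale
     ({Poly_Mapping.single (f(i := u \<oplus>\<^bsub>M i\<^esub> v)) 1
         - Poly_Mapping.single (f(i := u)) 1 - Poly_Mapping.single (f(i := v)) 1 | f i u v.
         f \<in> (\<Pi>\<^sub>E i\<in>I. carrier (M i)) \<and> i \<in> I \<and> u \<in> carrier (M i) \<and> v \<in> carrier (M i)}
    \<union> {Poly_Mapping.single (f(i := c \<odot>\<^bsub>M i\<^esub> u)) 1 - Poly_Mapping.single (f(i := u)) c | f i c u.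
         f \<in> (\<Pi>\<^sub>E i\<in>I. carrier (M i)) \<and> i \<in> I \<and> u \<in> carrier (M i)})"

definition tensor_class ::
  "'i set \<Rightarrow> ('i \<Rightarrow> ('a::field, 'v, 'g) rep) \<Rightarrow> (('i \<Rightarrow> 'v) \<Rightarrow>\<^sub>0 'a)
     \<Rightarrow> (('i \<Rightarrow> 'v) \<Rightarrow>\<^sub>0 'a) set" where
  "tensor_class I M x = {y. y - x \<in> tensor_relations I M}"

(* The tensor product of the linear maps \<phi> i for i in I, with values in the tensor
   product of the family W.  Operations on cosets are given by the union of the classes
   obtained from all representatives; when the operation is well defined, this is a
   union of equal sets. *)
definition tensor_map ::
  "'i set \<Rightarrow> ('i \<Rightarrow> ('a::field, 'w, 'g) rep) \<Rightarrow> ('i \<Rightarrow> 'v \<Rightarrow> 'w)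
     \<Rightarrow> (('i \<Rightarrow> 'v) \<Rightarrow>\<^sub>0 'a) set \<Rightarrow> (('i \<Rightarrow> 'w) \<Rightarrow>\<^sub>0 'a) set" where
  "tensor_map I W \<phi> A = (\<Union>x\<in>A. tensor_class I W
     (\<Sum>f\<in>Poly_Mapping.keys x.
        Poly_Mapping.single (\<lambda>i\<in>I. \<phi> i (f i)) (Poly_Mapping.lookup x f)))"

definition tensor ::
  "'i set \<Rightarrow> ('i \<Rightarrow> ('a::field, 'v, 'g) rep)
     \<Rightarrow> ('a, (('i \<Rightarrow> 'v) \<Rightarrow>\<^sub>0 'a) set, 'g) rep" where
  "tensor I M =
     \<lparr> carrier = tensor_class I M ` free_space (\<Pi>\<^sub>E i\<in>I. carrier (M i)),
       mult = undefined, one = undefined,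
       zero = tensor_class I M 0,
       add = (\<lambda>A B. \<Union>x\<in>A. \<Union>y\<in>B. tensor_class I M (x + y)),
       smult = (\<lambda>c A. \<Union>x\<in>A. tensor_class I M (free_scale c x)),
       act = (\<lambda>\<gamma>. tensor_map I M (\<lambda>i. act (M i) \<gamma>)) \<rparr>"

(* The type 'a poly poly is the polynomial ring in X (inner variable) and
   Y (outer variable): coeff (coeff f j) i is the coefficient of X^i * Y^j. *)

definition varX :: "'a::field poly poly" where "varX = [:[:0, 1:]:]"

definition varY :: "'a::field poly poly" where "varY = [:0, 1:]"

definition const2 :: "'a::field \<Rightarrow> 'a poly poly" where "const2 c = [:[:c:]:]"

definition dX :: "'a::field poly poly \<Rightarrow> 'a poly poly" where "dX = map_poly pderiv"

definition dY :: "'a::field poly poly \<Rightarrow> 'a poly poly" where "dY = pderiv"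

(* the image of f under the algebra endomorphism with X \<mapsto> u, Y \<mapsto> v *)
definition subst2 ::
  "'a::field poly poly \<Rightarrow> 'a poly poly \<Rightarrow> 'a poly poly \<Rightarrow> 'a poly poly" where
  "subst2 u v f = poly (map_poly (\<lambda>h. poly (map_poly const2 h) u) f) v"

(* The degree is an integer, so that homog (-1) is the zero module. *)
definition homog :: "int \<Rightarrow> ('a::field, 'a poly poly, 'a ^ 2 ^ 2) rep" where
  "homog k =
     \<lparr> carrier = {f. \<forall>i j. coeff (coeff f j) i \<noteq> 0 \<longrightarrow> int i + int j = k},
       mult = undefined, one = undefined,
       zero = 0,
       add = (+),
       smult = (\<lambda>c f. const2 c * f),
       act = (\<lambda>\<gamma>. subst2 (const2 (\<gamma>$1$1) * varX + const2 (\<gamma>$2$1) * varY)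
                         (const2 (\<gamma>$1$2) * varX + const2 (\<gamma>$2$2) * varY)) \<rparr>"

definition frobenius_twist ::
  "nat \<Rightarrow> nat \<Rightarrow> ('a::field, 'v, 'a ^ 2 ^ 2) rep \<Rightarrow> ('a, 'v, 'a ^ 2 ^ 2) rep" where
  "frobenius_twist p n M =
     M \<lparr> act := \<lambda>\<gamma>. act M (\<chi> i j. ((\<lambda>x. x ^ p) ^^ n) (\<gamma>$i$j)) \<rparr>"

definition twisted_homog ::
  "nat \<Rightarrow> (nat \<Rightarrow> int) \<Rightarrow> nat \<Rightarrow> ('a::field, 'a poly poly, 'a ^ 2 ^ 2) rep" where
  "twisted_homog p k i = frobenius_twist p i (homog (k i))"

definition tensor_homog ::
  "nat \<Rightarrow> nat \<Rightarrow> (nat \<Rightarrow> int)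
     \<Rightarrow> ('a::field, ((nat \<Rightarrow> 'a poly poly) \<Rightarrow>\<^sub>0 'a) set, 'a ^ 2 ^ 2) rep" where
  "tensor_homog p g k = tensor {0..g-1} (twisted_homog p k)"

definition D_beta_degrees :: "nat \<Rightarrow> nat \<Rightarrow> (nat \<Rightarrow> int) \<Rightarrow> nat \<Rightarrow> nat \<Rightarrow> nat \<Rightarrow> int" where
  "D_beta_degrees p g k \<alpha> \<beta> =
     k(\<alpha> := k \<alpha> - 1, (\<alpha> + \<beta>) mod g := k ((\<alpha> + \<beta>) mod g) + int (p ^ (g - \<beta>)))"

definition D_degrees :: "nat \<Rightarrow> nat \<Rightarrow> (nat \<Rightarrow> int) \<Rightarrow> nat \<Rightarrow> nat \<Rightarrow> int" where
  "D_degrees p g k \<alpha> = k(\<alpha> := k \<alpha> + (int (p ^ g) - 1))"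

(* The degrees k enter the two operators only to specify the codomain. *)

definition D_beta ::
  "nat \<Rightarrow> nat \<Rightarrow> (nat \<Rightarrow> int) \<Rightarrow> nat \<Rightarrow> nat
     \<Rightarrow> ((nat \<Rightarrow> 'a::field poly poly) \<Rightarrow>\<^sub>0 'a) set
     \<Rightarrow> ((nat \<Rightarrow> 'a poly poly) \<Rightarrow>\<^sub>0 'a) set" where
  "D_beta p g k \<alpha> \<beta> A =
     (let I = {0..g-1}; W = twisted_homog p (D_beta_degrees p g k \<alpha> \<beta>)
      in tensor_map I W
           ((\<lambda>i. id)(\<alpha> := dX, (\<alpha> + \<beta>) mod g := (*) (varX ^ p ^ (g - \<beta>)))) A
         \<oplus>\<^bsub>tensor I W\<^esub>
         tensor_map I W
           ((\<lambda>i. id)(\<alpha> := dY, (\<alpha> + \<beta>) mod g := (*) (varY ^ p ^ (g - \<beta>)))) A)"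

definition D_op ::
  "nat \<Rightarrow> nat \<Rightarrow> (nat \<Rightarrow> int) \<Rightarrow> nat
     \<Rightarrow> ((nat \<Rightarrow> 'a::field poly poly) \<Rightarrow>\<^sub>0 'a) set
     \<Rightarrow> ((nat \<Rightarrow> 'a poly poly) \<Rightarrow>\<^sub>0 'a) set" where
  "D_op p g k \<alpha> =
     tensor_map {0..g-1} (twisted_homog p (D_degrees p g k \<alpha>))
       ((\<lambda>i. id)(\<alpha> := \<lambda>f. varX ^ p ^ g * dX f + varY ^ p ^ g * dY f))"

end

(* Equivariance is the chain rule for a linear substitution, combined with the fact that
   raising to the power p^(g - \<beta>) turns the Frobenius twist of index \<alpha> + \<beta> into that of
   index \<alpha>: the matrix coefficients produced by the derivatives in one factor are moved
   across the tensor sign onto the powers of X and Y in the other.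

   For injectivity, let S_X and S_Y divide by X^Q and Y^Q, discarding the monomials that are
   not divisible.  When the degree of f is less than Q, one has S_X (Y^Q f) = 0 = S_Y (X^Q f),
   so (X \<otimes> S_X + Y \<otimes> S_Y) composed with the operator is X \<partial>_X + Y \<partial>_Y, which by Euler's
   identity is multiplication by the degree, invertible modulo p.  The same argument with
   X S_X + Y S_Y handles the operator on a single factor. *)

theory Submission
  imports Defs
begin

text \<open>In a tensor product given by generators and relations it is easy to prove that two
  elements agree and hard to prove that they differ. A left inverse turns injectivity into a
  statement about agreement, and by linearity it is enough to check that on pure tensors. The price
  is that every operator has to be shown to descend to cosets, which it does because the maps on the
  factors are linear. The two degree bounds act at different places. From 0 < k_\<alpha> \<le> p - 1
  the Euler factor k_\<alpha> is nonzero in the field. From k_{\<alpha>+\<beta>} \<le> p - 1 this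
  degree lies below Q = p^(g - \<beta>), which is at least p since \<beta> < g. For the operator on
  one factor Q is q, and the polynomials multiplied by X^q and Y^q are derivatives, of degree
  k_\<alpha> - 1 < q. Reading indices modulo g is harmless because x^q = x makes g Frobenius steps
  trivial on the field.\<close>

section \<open>Finite fields: characteristic and x^q = x\<close>

lemma card_UNIV_eq_zero: "of_nat CARD('a) = (0 :: 'a::{ring_1,finite})"
proof -
  \<comment> \<open>Translation by 1 permutes the ring, so adding 1 to every summand does not change
    the total.\<close>
  have "(\<Sum>x\<in>UNIV. x + 1) = (\<Sum>x\<in>UNIV. x :: 'a)"
    by (rule sum.reindex_bij_witness[of _ "\<lambda>x. x - 1" "\<lambda>x. x + 1"]) auto
  then show ?thesis
    by (simp add: sum.distrib)
qed

text \<open>A field has no nilpotents, so p^g = 0 forces p = 0; the characteristic then divides the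
  prime p and cannot be 1.\<close>

lemma CHAR_eq_prime:
  assumes "prime p" and "CARD('a::{field,finite}) = p ^ g"
  shows "CHAR('a) = p"
proof -
  have "of_nat p = (0 :: 'a)"
    using card_UNIV_eq_zero[where 'a = 'a] assms(2) by (auto simp: of_nat_power)
  then have "CHAR('a) dvd p"
    using of_nat_eq_0_iff_char_dvd by blast
  then show ?thesis
    using assms(1) by (auto simp: prime_nat_iff)
qed

text \<open>Multiplication by a nonzero x permutes the nonzero elements; comparing their products
  and cancelling gives x^(q-1) = 1.\<close>

lemma power_card_UNIV_eq: "x ^ CARD('a) = (x :: 'a::{field,finite})"
proof (cases "x = 0")
  case False
  have "(\<Prod>y\<in>UNIV - {0}. x * y) = (\<Prod>y\<in>UNIV - {0}. y)"
    by (rule prod.reindex_bij_witness[of _ "\<lambda>y. y / x" "\<lambda>y. x * y"]) (use False in auto)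
  then have "x ^ (CARD('a) - 1) = 1"
    by (simp add: prod.distrib)
  then show ?thesis
    using power_minus_mult[of "CARD('a)" x] by simp
qed (simp add: zero_power)

section \<open>Substitution in polynomials in two variables\<close>

text \<open>\<open>subst2\<close> nests the same operation twice: map the coefficients, then
  evaluate. Additivity and multiplicativity are therefore proved for an arbitrary
  \<open>\<phi>\<close> and applied once per variable.\<close>

lemma poly_map_poly_add:
  assumes "\<phi> 0 = 0" and "\<And>a b. \<phi> (a + b) = \<phi> a + \<phi> b"
  shows "poly (map_poly \<phi> (f + g)) v = poly (map_poly \<phi> f) v + poly (map_poly \<phi> g) v"
proof -
  have "map_poly \<phi> (f + g) = map_poly \<phi> f + map_poly \<phi> g"
    by (rule poly_eqI) (simp add: coeff_map_poly assms)
  then show ?thesis by simp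
qed

lemma poly_map_poly_mult:
  fixes \<phi> :: "'b::comm_semiring_0 \<Rightarrow> 'c::comm_semiring_0"
  assumes "\<phi> 0 = 0" and "\<And>a b. \<phi> (a + b) = \<phi> a + \<phi> b" and "\<And>a b. \<phi> (a * b) = \<phi> a * \<phi> b"
  shows "poly (map_poly \<phi> (f * g)) v = poly (map_poly \<phi> f) v * poly (map_poly \<phi> g) v"
proof (induction f)
  case (pCons a f)
  have "map_poly \<phi> (Polynomial.smult a g) = Polynomial.smult (\<phi> a) (map_poly \<phi> g)"
    by (rule poly_eqI) (simp add: coeff_map_poly assms)
  then show ?case
    by (simp add: map_poly_pCons assms poly_map_poly_add pCons.IH algebra_simps)
qed simp

lemma const2_0 [simp]: "const2 0 = 0" and const2_1 [simp]: "const2 1 = 1"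
  and const2_add: "const2 (a + b) = const2 a + const2 b"
  and const2_mult: "const2 (a * b) = const2 a * const2 b"
  by (simp_all add: const2_def one_pCons)

lemma const2_power: "const2 (a ^ n) = const2 a ^ n"
  by (induction n) (simp_all add: const2_mult)

lemma coeff_const2_mult [simp]: "coeff (coeff (const2 c * f) j) i = c * coeff (coeff f j) i"
  by (simp add: const2_def)

lemma varX_power: "varX ^ n = [:monom 1 n:]"
  by (induction n) (simp_all add: varX_def monom_Suc one_pCons monom_0 mult.commute)

lemma varY_power: "varY ^ n = monom 1 n"
  by (induction n) (simp_all add: varY_def monom_Suc)

lemma const2_monomial: "const2 c * varX ^ i * varY ^ j = monom (monom c i) j"
  by (simp add: const2_def varX_power varY_power smult_monom)

lemma poly2_expand:
  "f = (\<Sum>j\<le>degree f. \<Sum>i\<le>degree (coeff f j). const2 (coeff (coeff f j) i) * varX ^ i * varY ^ j)"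
proof -
  have "(\<Sum>i\<le>degree h. monom (monom (coeff h i) i) j) = monom h j" for h :: "'a poly" and j
    using poly_as_sum_of_monoms[of h] by (metis monom_sum)
  then show ?thesis
    by (simp add: const2_monomial poly_as_sum_of_monoms)
qed

text \<open>The constants and the two variables generate the polynomial ring as a ring. This serves
  the chain rule, where both sides behave well under sums and products.\<close>

lemma poly2_induct [case_names const varX varY add mult]:
  assumes "\<And>c. P (const2 c)" and "P varX" and "P varY"
    and "\<And>f g. P f \<Longrightarrow> P g \<Longrightarrow> P (f + g)" and "\<And>f g. P f \<Longrightarrow> P g \<Longrightarrow> P (f * g)"
  shows "P f"
proof -
  have inner: "P [:h:]" for h
  proof (induction h)
    case 0
    then show ?case using assms(1)[of 0] by simp
  next
    case (pCons c h)
    have "[:pCons c h:] = const2 c + varX * [:h:]"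
      by (simp add: const2_def varX_def)
    then show ?case using pCons assms by metis
  qed
  show ?thesis
  proof (induction f)
    case 0
    then show ?case using inner[of 0] by simp
  next
    case (pCons h f)
    have "pCons h f = [:h:] + varY * f"
      by (simp add: varY_def)
    then show ?case using pCons inner assms by metis
  qed
qed

lemma eval_const2_add:
  "poly (map_poly const2 (h + h')) u = poly (map_poly const2 h) u + poly (map_poly const2 h') u"
  by (rule poly_map_poly_add) (simp_all add: const2_add)

lemma eval_const2_mult:
  "poly (map_poly const2 (h * h')) u = poly (map_poly const2 h) u * poly (map_poly const2 h') u"
  by (rule poly_map_poly_mult) (simp_all add: const2_add const2_mult)

lemma subst2_0 [simp]: "subst2 u v 0 = 0"
  by (simp add: subst2_def)

lemma subst2_add: "subst2 u v (f + g) = subst2 u v f + subst2 u v g"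
  unfolding subst2_def by (rule poly_map_poly_add) (simp_all add: eval_const2_add)

lemma subst2_mult: "subst2 u v (f * g) = subst2 u v f * subst2 u v g"
  unfolding subst2_def
  by (rule poly_map_poly_mult) (simp_all add: eval_const2_add eval_const2_mult)

lemma subst2_const2 [simp]: "subst2 u v (const2 c) = const2 c"
  by (cases "c = 0") (simp_all add: subst2_def const2_def map_poly_pCons)

lemma subst2_varX [simp]: "subst2 u v varX = u"
  by (simp add: subst2_def varX_def map_poly_pCons)

lemma subst2_varY [simp]: "subst2 u v varY = v"
  by (simp add: subst2_def varY_def map_poly_pCons flip: one_pCons const2_def)

lemma subst2_sum: "subst2 u v (sum f A) = (\<Sum>x\<in>A. subst2 u v (f x))"
  by (induction A rule: infinite_finite_induct) (simp_all add: subst2_add)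

lemma subst2_power: "subst2 u v (f ^ n) = subst2 u v f ^ n"
  using subst2_const2[of u v 1] by (induction n) (simp_all add: subst2_mult)

section \<open>Partial derivatives and the chain rule\<close>

lemma coeff_dX: "coeff (coeff (dX f) j) i = of_nat (Suc i) * coeff (coeff f j) (Suc i)"
  by (simp add: dX_def coeff_map_poly coeff_pderiv)

lemma coeff_dY: "coeff (coeff (dY f) j) i = of_nat (Suc j) * coeff (coeff f (Suc j)) i"
  by (simp add: dY_def coeff_pderiv of_nat_poly)

lemma dX_add: "dX (f + g) = dX f + dX g"
  by (simp add: poly_eq_iff coeff_dX algebra_simps)

lemma dY_add: "dY (f + g) = dY f + dY g"
  by (simp add: dY_def pderiv_add)

lemma dX_mult: "dX (f * g) = dX f * g + f * dX g"
proof (rule poly_eqI)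
  \<comment> \<open>\<open>dX\<close> differentiates each coefficient of the outer polynomial, so
    its Leibniz rule comes termwise from the convolution formula, which requires
    \<open>pderiv\<close> to pass through sums.\<close>
  have "pderiv (sum h A) = (\<Sum>x\<in>A. pderiv (h x))" for h :: "nat \<Rightarrow> 'a poly" and A
    by (induction A rule: infinite_finite_induct) (simp_all add: pderiv_add)
  then show "coeff (dX (f * g)) n = coeff (dX f * g + f * dX g) n" for n
    unfolding coeff_add coeff_mult
    by (simp add: dX_def coeff_map_poly coeff_mult pderiv_mult add.commute mult.commute flip: sum.distrib)
qed

lemma dY_mult: "dY (f * g) = dY f * g + f * dY g"
  by (simp add: dY_def pderiv_mult algebra_simps)

lemma dX_const2 [simp]: "dX (const2 c) = 0" and dY_const2 [simp]: "dY (const2 c) = 0"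
  and dX_varX [simp]: "dX varX = 1" and dX_varY [simp]: "dX varY = 0"
  and dY_varX [simp]: "dY varX = 0" and dY_varY [simp]: "dY varY = 1"
  by (simp_all add: dX_def dY_def const2_def varX_def varY_def map_poly_pCons pderiv_pCons one_pCons)

text \<open>Both sides are derivations in f along the substitution homomorphism, so it suffices that
  they agree on the generators.\<close>

lemma dX_subst2: "dX (subst2 u v f) = subst2 u v (dX f) * dX u + subst2 u v (dY f) * dX v"
proof (induction f rule: poly2_induct)
  case (mult f g)
  then show ?case
    by (simp add: subst2_mult subst2_add dX_mult dY_mult algebra_simps)
qed (use subst2_const2[of u v 1] in \<open>simp_all add: subst2_add dX_add dY_add algebra_simps\<close>)

lemma dY_subst2: "dY (subst2 u v f) = subst2 u v (dX f) * dY u + subst2 u v (dY f) * dY v"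
proof (induction f rule: poly2_induct)
  case (mult f g)
  then show ?case
    by (simp add: subst2_mult subst2_add dX_mult dY_mult algebra_simps)
qed (use subst2_const2[of u v 1] in \<open>simp_all add: subst2_add dX_add dY_add algebra_simps\<close>)

text \<open>The action of a matrix with rows (a, b) and (c, d). Taking four scalars lets
  Frobenius-twisted entries be inserted directly.\<close>

definition linear_subst ::
  "'a::field \<Rightarrow> 'a \<Rightarrow> 'a \<Rightarrow> 'a \<Rightarrow> 'a poly poly \<Rightarrow> 'a poly poly" where
  "linear_subst a b c d =
     subst2 (const2 a * varX + const2 c * varY) (const2 b * varX + const2 d * varY)"

lemma linear_subst_add:
  "linear_subst a b c d (f + h) = linear_subst a b c d f + linear_subst a b c d h"
  by (simp add: linear_subst_def subst2_add)

lemma linear_subst_mult: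
  "linear_subst a b c d (f * h) = linear_subst a b c d f * linear_subst a b c d h"
  by (simp add: linear_subst_def subst2_mult)

lemma linear_subst_const2 [simp]: "linear_subst a b c d (const2 e) = const2 e"
  by (simp add: linear_subst_def)

text \<open>Derivatives pick up the rows (a, b) and (c, d), whereas powers of X and Y pick up the
  columns (a, c) and (b, d). This duality is what cancels in the equivariance proofs.\<close>

lemma dX_linear_subst:
  "dX (linear_subst a b c d f)
     = const2 a * linear_subst a b c d (dX f) + const2 b * linear_subst a b c d (dY f)"
  by (simp add: linear_subst_def dX_subst2 dX_add dX_mult mult.commute)

lemma dY_linear_subst:
  "dY (linear_subst a b c d f)
     = const2 c * linear_subst a b c d (dX f) + const2 d * linear_subst a b c d (dY f)"
  by (simp add: linear_subst_def dY_subst2 dY_add dY_mult mult.commute)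

text \<open>Raising to a power of the characteristic is additive, so no mixed monomials appear and
  X^Q, Y^Q again span a space stable under the substitution.\<close>

lemma linear_subst_varX_power:
  fixes a b c d :: "'a::field" and n :: nat
  assumes "prime CHAR('a)"
  defines "Q \<equiv> CHAR('a) ^ n"
  shows "linear_subst a b c d (varX ^ Q) = const2 (a ^ Q) * varX ^ Q + const2 (c ^ Q) * varY ^ Q"
  using freshmans_dream'[of Q n "const2 a * varX" "const2 c * varY"] assms
  by (simp add: linear_subst_def subst2_power power_mult_distrib const2_power)

lemma linear_subst_varY_power:
  fixes a b c d :: "'a::field" and n :: nat
  assumes "prime CHAR('a)"
  defines "Q \<equiv> CHAR('a) ^ n"
  shows "linear_subst a b c d (varY ^ Q) = const2 (b ^ Q) * varX ^ Q + const2 (d ^ Q) * varY ^ Q"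
  using freshmans_dream'[of Q n "const2 b * varX" "const2 d * varY"] assms
  by (simp add: linear_subst_def subst2_power power_mult_distrib const2_power)

section \<open>Homogeneous polynomials\<close>

lemma homog_simps [simp]:
  "add (homog k) = (+)" "smult (homog k) = (\<lambda>c f. const2 c * f)"
  by (simp_all add: homog_def)

lemma mem_homog:
  "f \<in> carrier (homog k) \<longleftrightarrow> (\<forall>i j. coeff (coeff f j) i \<noteq> 0 \<longrightarrow> int i + int j = k)"
  by (simp add: homog_def)

lemma homog_0 [simp]: "0 \<in> carrier (homog k)"
  by (simp add: mem_homog)

lemma homog_const2: "const2 c \<in> carrier (homog 0)"
  by (auto simp: mem_homog const2_def coeff_pCons split: nat.splits)

lemma homog_varX: "varX \<in> carrier (homog 1)"
  by (auto simp: mem_homog varX_def coeff_pCons split: nat.splits)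

lemma homog_varY: "varY \<in> carrier (homog 1)"
  by (auto simp: mem_homog varY_def coeff_pCons split: nat.splits)

lemma homog_add: "f \<in> carrier (homog k) \<Longrightarrow> g \<in> carrier (homog k) \<Longrightarrow> f + g \<in> carrier (homog k)"
  unfolding mem_homog coeff_add by (metis add_0)

lemma homog_sum: "(\<And>x. x \<in> A \<Longrightarrow> f x \<in> carrier (homog k)) \<Longrightarrow> sum f A \<in> carrier (homog k)"
  by (induction A rule: infinite_finite_induct) (simp_all add: homog_add)

text \<open>The degree \<open>m\<close> is a separate variable so that the rule matches any
  expression equal to the sum of the degrees.\<close>

lemma homog_mult:
  assumes "f \<in> carrier (homog k)" and "g \<in> carrier (homog l)" and "m = k + l"
  shows "f * g \<in> carrier (homog m)"
  unfolding mem_homog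
proof (intro allI impI)
  fix i j assume "coeff (coeff (f * g) j) i \<noteq> 0"
  then obtain j' i' where "j' \<le> j" "i' \<le> i"
      and "coeff (coeff f j') i' * coeff (coeff g (j - j')) (i - i') \<noteq> 0"
    unfolding coeff_mult coeff_sum by (metis (no_types, lifting) atMost_iff sum.neutral)
  then have "int i' + int j' = k" "int (i - i') + int (j - j') = l"
    using assms(1,2) unfolding mem_homog by (metis mult_zero_left mult_zero_right)+
  then show "int i + int j = m"
    using \<open>j' \<le> j\<close> \<open>i' \<le> i\<close> assms(3) by linarith
qed

lemma homog_power: "f \<in> carrier (homog k) \<Longrightarrow> f ^ n \<in> carrier (homog (int n * k))"
proof (induction n)
  case 0
  then show ?case using homog_const2[of 1] by simp
next
  case (Suc n)
  then show ?case by (simp add: homog_mult algebra_simps)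
qed

lemma homog_varX_power: "varX ^ n \<in> carrier (homog (int n))"
  using homog_power[OF homog_varX, of n] by simp

lemma homog_varY_power: "varY ^ n \<in> carrier (homog (int n))"
  using homog_power[OF homog_varY, of n] by simp

lemma homog_smult: "f \<in> carrier (homog k) \<Longrightarrow> const2 c * f \<in> carrier (homog k)"
  by (rule homog_mult[OF homog_const2]) simp_all

lemma homog_dX: "f \<in> carrier (homog k) \<Longrightarrow> dX f \<in> carrier (homog (k - 1))"
  unfolding mem_homog coeff_dX
proof (intro allI impI)
  fix i j
  assume f: "\<forall>i j. coeff (coeff f j) i \<noteq> 0 \<longrightarrow> int i + int j = k"
    and "of_nat (Suc i) * coeff (coeff f j) (Suc i) \<noteq> 0"
  then have "coeff (coeff f j) (Suc i) \<noteq> 0"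
    by auto
  with f have "int (Suc i) + int j = k"
    by blast
  then show "int i + int j = k - 1"
    by simp
qed

lemma homog_dY: "f \<in> carrier (homog k) \<Longrightarrow> dY f \<in> carrier (homog (k - 1))"
  unfolding mem_homog coeff_dY
proof (intro allI impI)
  fix i j
  assume f: "\<forall>i j. coeff (coeff f j) i \<noteq> 0 \<longrightarrow> int i + int j = k"
    and "of_nat (Suc j) * coeff (coeff f (Suc j)) i \<noteq> 0"
  then have "coeff (coeff f (Suc j)) i \<noteq> 0"
    by auto
  with f have "int i + int (Suc j) = k"
    by blast
  then show "int i + int j = k - 1"
    by simp
qed

text \<open>Linear forms turn X^i Y^j into a form of degree i + j, and only monomials with i + j = k
  occur in f.\<close>

lemma homog_subst2:
  assumes "u \<in> carrier (homog 1)" and "v \<in> carrier (homog 1)" and "f \<in> carrier (homog k)"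
  shows "subst2 u v f \<in> carrier (homog k)"
proof -
  have "const2 (coeff (coeff f j) i) * u ^ i * v ^ j \<in> carrier (homog k)" for i j
  proof (cases "coeff (coeff f j) i = 0")
    case False
    then have "int i + int j = k"
      using assms(3) by (auto simp: mem_homog)
    then show ?thesis
      using homog_power[OF assms(1), of i] homog_power[OF assms(2), of j]
      by (auto intro!: homog_mult[where k = "int i" and l = "int j"] homog_smult)
  qed simp
  then show ?thesis
    by (subst poly2_expand[of f]) (simp add: subst2_sum subst2_mult subst2_power homog_sum)
qed

lemma homog_linear_subst:
  "f \<in> carrier (homog k) \<Longrightarrow> linear_subst a b c d f \<in> carrier (homog k)"
  unfolding linear_subst_def
  by (intro homog_subst2 homog_add homog_smult homog_varX homog_varY)

text \<open>The monomial X^i Y^j is an eigenvector of X \<partial>_X with eigenvalue i and of Y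
  \<partial>_Y with eigenvalue j.\<close>

lemma euler_homog:
  assumes "f \<in> carrier (homog (int k))"
  shows "varX * dX f + varY * dY f = const2 (of_nat k) * f"
proof (intro poly_eqI)
  fix i j
  have "coeff (coeff (varX * dX f) j) i = of_nat i * coeff (coeff f j) i"
    by (cases i) (simp_all add: varX_def coeff_dX)
  moreover have "coeff (coeff (varY * dY f) j) i = of_nat j * coeff (coeff f j) i"
    by (cases j) (simp_all add: varY_def coeff_dY)
  moreover have "(of_nat i + of_nat j) * coeff (coeff f j) i = of_nat k * coeff (coeff f j) i"
  proof (cases "coeff (coeff f j) i = 0")
    case False
    then have "int i + int j = int k"
      using assms by (auto simp only: mem_homog)
    then have "i + j = k" by linarith
    then show ?thesis by auto
  qed simp
  ultimately show "coeff (coeff (varX * dX f + varY * dY f) j) i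
      = coeff (coeff (const2 (of_nat k) * f) j) i"
    by (simp add: ring_distribs)
qed

text \<open>Left inverses of multiplication by \<open>X ^ n\<close> and \<open>Y ^ n\<close> which, in low degree, annihilate the
  multiples of the other power.\<close>

definition shiftX :: "nat \<Rightarrow> 'a::field poly poly \<Rightarrow> 'a poly poly" where
  "shiftX n = map_poly (poly_shift n)"

definition shiftY :: "nat \<Rightarrow> 'a::field poly poly \<Rightarrow> 'a poly poly" where
  "shiftY n = poly_shift n"

lemma coeff_shiftX: "coeff (coeff (shiftX n f) j) i = coeff (coeff f j) (i + n)"
  by (simp add: shiftX_def coeff_map_poly coeff_poly_shift)

lemma coeff_shiftY: "coeff (coeff (shiftY n f) j) i = coeff (coeff f (j + n)) i"
  by (simp add: shiftY_def coeff_poly_shift)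

lemma coeff_varX_power_mult:
  "coeff (coeff (varX ^ n * f) j) i = (if i < n then 0 else coeff (coeff f j) (i - n))"
  by (simp add: varX_power coeff_monom_mult)

lemma coeff_varY_power_mult:
  "coeff (coeff (varY ^ n * f) j) i = (if j < n then 0 else coeff (coeff f (j - n)) i)"
  by (simp add: varY_power coeff_monom_mult)

lemma shiftX_add: "shiftX n (f + g) = shiftX n f + shiftX n g"
  by (simp add: poly_eq_iff coeff_shiftX)

lemma shiftY_add: "shiftY n (f + g) = shiftY n f + shiftY n g"
  by (simp add: poly_eq_iff coeff_shiftY)

lemma shiftX_smult: "shiftX n (const2 c * f) = const2 c * shiftX n f"
  by (simp add: poly_eq_iff coeff_shiftX)

lemma shiftY_smult: "shiftY n (const2 c * f) = const2 c * shiftY n f"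
  by (simp add: poly_eq_iff coeff_shiftY)

lemma homog_shiftX: "f \<in> carrier (homog (k + int n)) \<Longrightarrow> shiftX n f \<in> carrier (homog k)"
  by (force simp: mem_homog coeff_shiftX)

lemma homog_shiftY: "f \<in> carrier (homog (k + int n)) \<Longrightarrow> shiftY n f \<in> carrier (homog k)"
  by (force simp: mem_homog coeff_shiftY)

lemma shiftX_varX_power_mult [simp]: "shiftX n (varX ^ n * f) = f"
  by (simp add: poly_eq_iff coeff_shiftX coeff_varX_power_mult)

lemma shiftY_varY_power_mult [simp]: "shiftY n (varY ^ n * f) = f"
  by (simp add: poly_eq_iff coeff_shiftY coeff_varY_power_mult)

text \<open>Multiplication by Y^n leaves the exponents of X alone, and in f these are at most k < n;
  hence no monomial is divisible by X^n.\<close>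

lemma shiftX_varY_power_mult:
  assumes "f \<in> carrier (homog k)" and "k < int n"
  shows "shiftX n (varY ^ n * f) = 0"
  using assms by (fastforce simp: poly_eq_iff coeff_shiftX coeff_varY_power_mult mem_homog)

lemma shiftY_varX_power_mult:
  assumes "f \<in> carrier (homog k)" and "k < int n"
  shows "shiftY n (varX ^ n * f) = 0"
  using assms by (fastforce simp: poly_eq_iff coeff_shiftY coeff_varX_power_mult mem_homog)

section \<open>Formal linear combinations\<close>

lemma lookup_free_scale [simp]:
  "Poly_Mapping.lookup (free_scale c x) s = c * Poly_Mapping.lookup x s"
  by (simp add: free_scale_def Poly_Mapping.map.rep_eq when_def)

interpretation free: vector_space "free_scale :: 'a::field \<Rightarrow> ('s \<Rightarrow>\<^sub>0 'a) \<Rightarrow> ('s \<Rightarrow>\<^sub>0 'a)"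
  by standard (simp_all add: poly_mapping_eq_iff fun_eq_iff lookup_add algebra_simps)

lemma free_scale_single [simp]: "free_scale c (Poly_Mapping.single s a) = Poly_Mapping.single s (c * a)"
  by (simp add: poly_mapping_eq_iff fun_eq_iff lookup_single when_def)

lemma free_decomp:
  "x = (\<Sum>s\<in>Poly_Mapping.keys x. free_scale (Poly_Mapping.lookup x s) (Poly_Mapping.single s 1))"
proof (rule poly_mapping_eqI)
  fix t
  have "(\<Sum>s\<in>Poly_Mapping.keys x. Poly_Mapping.lookup x s when s = t) = Poly_Mapping.lookup x t"
    by (simp add: when_def in_keys_iff sum.delta)
  then show "Poly_Mapping.lookup x t = Poly_Mapping.lookup
      (\<Sum>s\<in>Poly_Mapping.keys x. free_scale (Poly_Mapping.lookup x s) (Poly_Mapping.single s 1)) t"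
    by (simp add: lookup_sum lookup_single)
qed

text \<open>The linear map of free spaces induced by a map of basis elements. Its body has the shape
  of the sum inside \<open>tensor_map\<close>, which can thus be folded into it.\<close>

definition pushforward :: "('s \<Rightarrow> 't) \<Rightarrow> ('s \<Rightarrow>\<^sub>0 'a::field) \<Rightarrow> ('t \<Rightarrow>\<^sub>0 'a)" where
  "pushforward h x =
     (\<Sum>s\<in>Poly_Mapping.keys x. Poly_Mapping.single (h s) (Poly_Mapping.lookup x s))"

lemma pushforward_single [simp]:
  "pushforward h (Poly_Mapping.single s c) = Poly_Mapping.single (h s) c"
  by (simp add: pushforward_def)

lemma pushforward_0 [simp]: "pushforward h 0 = 0"
  by (simp add: pushforward_def)

lemma pushforward_add: "pushforward h (x + y) = pushforward h x + pushforward h y"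
  unfolding pushforward_def
  by (rule setsum_keys_plus_distrib[of "\<lambda>s. Poly_Mapping.single (h s)"]) (simp_all add: single_add)

lemma pushforward_scale: "pushforward h (free_scale c x) = free_scale c (pushforward h x)"
\<comment> \<open>Scaling preserves the support only for nonzero scalars.\<close>
proof (cases "c = 0")
  case False
  then have "Poly_Mapping.keys (free_scale c x) = Poly_Mapping.keys x"
    by (auto simp: in_keys_iff)
  then show ?thesis
    by (simp add: pushforward_def free.scale_sum_right)
qed simp

lemma linear_pushforward: "Vector_Spaces.linear free_scale free_scale (pushforward h)"
  by unfold_locales (simp_all add: pushforward_add pushforward_scale)

lemma pushforward_diff: "pushforward h (x - y) = pushforward h x - pushforward h y"
  using pushforward_add[of h "x - y" y] by simp

lemma pushforward_pushforward:
  fixes x :: "'s \<Rightarrow>\<^sub>0 'a::field"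
  shows "pushforward h (pushforward h' x) = pushforward (\<lambda>s. h (h' s)) x"
proof -
  have "pushforward h (sum F A) = (\<Sum>s\<in>A. pushforward h (F s))" for F :: "'s \<Rightarrow> _ \<Rightarrow>\<^sub>0 'a" and A
    by (induction A rule: infinite_finite_induct) (simp_all add: pushforward_add)
  then show ?thesis
    by (simp add: pushforward_def[of h'] pushforward_def[of "\<lambda>s. h (h' s)"])
qed

lemma pushforward_free_space:
  assumes "h \<in> S \<rightarrow> T" and "x \<in> free_space S"
  shows "pushforward h x \<in> free_space T"
proof -
  have "Poly_Mapping.keys (pushforward h x) \<subseteq> h ` Poly_Mapping.keys x"
    unfolding pushforward_def by (rule order_trans[OF keys_sum]) auto
  then show ?thesis
    using assms by (auto simp: free_space_def)
qed

lemma free_space_add: "x \<in> free_space S \<Longrightarrow> y \<in> free_space S \<Longrightarrow> x + y \<in> free_space S"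
  unfolding free_space_def using Poly_Mapping.keys_add[of x y] by blast

lemma free_space_scale: "x \<in> free_space S \<Longrightarrow> free_scale c x \<in> free_space S"
  by (auto simp: free_space_def in_keys_iff)

section \<open>Calculating modulo the multilinearity relations\<close>

text \<open>Equality in the tensor product, phrased on representatives so that calculations can be
  chained without handling cosets.\<close>

definition tensor_cong ::
  "'i set \<Rightarrow> ('i \<Rightarrow> ('a::field, 'v, 'g) rep) \<Rightarrow> (('i \<Rightarrow> 'v) \<Rightarrow>\<^sub>0 'a) \<Rightarrow> (('i \<Rightarrow> 'v) \<Rightarrow>\<^sub>0 'a) \<Rightarrow> bool" where
  "tensor_cong I M x y \<longleftrightarrow> x - y \<in> tensor_relations I M"

lemma subspace_tensor_relations: "free.subspace (tensor_relations I M)"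
  by (simp add: tensor_relations_def)

lemma zero_in_tensor_relations [simp]: "0 \<in> tensor_relations I M"
  by (rule free.subspace_0[OF subspace_tensor_relations])

lemma tensor_cong_refl [simp, intro]: "tensor_cong I M x x"
  by (simp add: tensor_cong_def)

lemma tensor_cong_sym: "tensor_cong I M x y \<Longrightarrow> tensor_cong I M y x"
  unfolding tensor_cong_def
  using free.subspace_neg[OF subspace_tensor_relations, of "x - y"] by simp

lemma tensor_cong_add:
  assumes "tensor_cong I M x x'" and "tensor_cong I M y y'"
  shows "tensor_cong I M (x + y) (x' + y')"
  using free.subspace_add[OF subspace_tensor_relations assms[unfolded tensor_cong_def]]
  by (simp add: tensor_cong_def algebra_simps)

lemma tensor_cong_trans [trans]:
  assumes "tensor_cong I M x y" and "tensor_cong I M y z"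
  shows "tensor_cong I M x z"
  using free.subspace_add[OF subspace_tensor_relations assms[unfolded tensor_cong_def]]
  by (simp add: tensor_cong_def)

lemma tensor_cong_scale:
  assumes "tensor_cong I M x y"
  shows "tensor_cong I M (free_scale c x) (free_scale c y)"
  using free.subspace_scale[OF subspace_tensor_relations assms[unfolded tensor_cong_def], of c]
  by (simp add: tensor_cong_def free.scale_right_diff_distrib)

lemma tensor_class_eq_iff: "tensor_class I M x = tensor_class I M y \<longleftrightarrow> tensor_cong I M x y"
proof
  assume "tensor_class I M x = tensor_class I M y"
  moreover have "x \<in> tensor_class I M x"
    by (simp add: tensor_class_def)
  ultimately show "tensor_cong I M x y"
    by (simp add: tensor_class_def tensor_cong_def)
next
  assume "tensor_cong I M x y"
  then show "tensor_class I M x = tensor_class I M y"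
    unfolding tensor_class_def tensor_cong_def[symmetric]
    by (blast intro: tensor_cong_trans tensor_cong_sym)
qed

text \<open>Operations on cosets are unions over all representatives. Once \<open>F\<close> respects
  congruence, every set in the union is the same one.\<close>

lemma UN_tensor_class:
  assumes "\<And>y. tensor_cong I M y x \<Longrightarrow> tensor_cong J N (F y) (F x)"
  shows "(\<Union>y\<in>tensor_class I M x. tensor_class J N (F y)) = tensor_class J N (F x)"
proof -
  have "tensor_class J N (F y) = tensor_class J N (F x)" if "y \<in> tensor_class I M x" for y
    using that assms[of y] by (simp add: tensor_class_eq_iff) (simp add: tensor_class_def tensor_cong_def)
  moreover have "x \<in> tensor_class I M x"
    by (simp add: tensor_class_def)
  ultimately show ?thesis by blast
qed

lemma tensor_class_plus:
  "tensor_class I M x \<oplus>\<^bsub>tensor I M\<^esub> tensor_class I M y = tensor_class I M (x + y)"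
proof -
  have "(\<Union>y'\<in>tensor_class I M y. tensor_class I M (x' + y')) = tensor_class I M (x' + y)" for x'
    by (rule UN_tensor_class) (simp add: tensor_cong_add)
  moreover have "(\<Union>x'\<in>tensor_class I M x. tensor_class I M (x' + y)) = tensor_class I M (x + y)"
    by (rule UN_tensor_class) (simp add: tensor_cong_add)
  ultimately show ?thesis
    by (simp add: tensor_def)
qed

lemma tensor_class_smult:
  "c \<odot>\<^bsub>tensor I M\<^esub> tensor_class I M x = tensor_class I M (free_scale c x)"
  using UN_tensor_class[of I M x I M "free_scale c"] by (simp add: tensor_def tensor_cong_scale)

lemma tensor_cong_single_add:
  assumes "f \<in> (\<Pi>\<^sub>E i\<in>I. carrier (M i))" and "i \<in> I" and "u \<in> carrier (M i)" and "v \<in> carrier (M i)"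
  shows "tensor_cong I M (Poly_Mapping.single (f(i := u \<oplus>\<^bsub>M i\<^esub> v)) c)
           (Poly_Mapping.single (f(i := u)) c + Poly_Mapping.single (f(i := v)) c)"
proof -
  have "tensor_cong I M (Poly_Mapping.single (f(i := u \<oplus>\<^bsub>M i\<^esub> v)) 1)
           (Poly_Mapping.single (f(i := u)) 1 + Poly_Mapping.single (f(i := v)) 1)"
    unfolding tensor_cong_def tensor_relations_def diff_diff_eq[symmetric]
    by (rule free.span_base) (use assms in blast)
  from tensor_cong_scale[OF this, of c] show ?thesis
    by (simp add: free.scale_right_distrib)
qed

lemma tensor_cong_single_smult:
  assumes "f \<in> (\<Pi>\<^sub>E i\<in>I. carrier (M i))" and "i \<in> I" and "u \<in> carrier (M i)"
  shows "tensor_cong I M (Poly_Mapping.single (f(i := a \<odot>\<^bsub>M i\<^esub> u)) c)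
           (Poly_Mapping.single (f(i := u)) (c * a))"
proof -
  have "tensor_cong I M (Poly_Mapping.single (f(i := a \<odot>\<^bsub>M i\<^esub> u)) 1)
           (Poly_Mapping.single (f(i := u)) a)"
    unfolding tensor_cong_def tensor_relations_def
    by (rule free.span_base) (use assms in blast)
  from tensor_cong_scale[OF this, of c] show ?thesis
    by simp
qed

lemma tensor_cong_single_lincomb:
  assumes "f \<in> (\<Pi>\<^sub>E i\<in>I. carrier (M i))" and "i \<in> I" and "u \<in> carrier (M i)" and "v \<in> carrier (M i)"
    and "\<And>c w. w \<in> carrier (M i) \<Longrightarrow> c \<odot>\<^bsub>M i\<^esub> w \<in> carrier (M i)"
  shows "tensor_cong I M
           (Poly_Mapping.single (f(i := (a \<odot>\<^bsub>M i\<^esub> u) \<oplus>\<^bsub>M i\<^esub> (b \<odot>\<^bsub>M i\<^esub> v))) 1)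
           (Poly_Mapping.single (f(i := u)) a + Poly_Mapping.single (f(i := v)) b)"
proof -
  note tensor_cong_single_add[OF assms(1,2) assms(5)[OF assms(3), of a] assms(5)[OF assms(4), of b],
      where c = 1]
  also note tensor_cong_add[OF tensor_cong_single_smult[OF assms(1-3), of a 1]
      tensor_cong_single_smult[OF assms(1,2,4), of b 1]]
  finally show ?thesis by simp
qed

text \<open>Moving a \<open>2 \<times> 2\<close> matrix across two tensor factors.\<close>

lemma tensor_cong_exchange:
  assumes f: "f \<in> (\<Pi>\<^sub>E i\<in>I. carrier (M i))" and ij: "i \<in> I" "j \<in> I" "i \<noteq> j"
    and u: "u \<in> carrier (M i)" "u' \<in> carrier (M i)" and v: "v \<in> carrier (M j)" "v' \<in> carrier (M j)"
    and cl: "\<And>l c w. l \<in> I \<Longrightarrow> w \<in> carrier (M l) \<Longrightarrow> c \<odot>\<^bsub>M l\<^esub> w \<in> carrier (M l)"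
  shows "tensor_cong I M
    (Poly_Mapping.single (f(i := (a \<odot>\<^bsub>M i\<^esub> u) \<oplus>\<^bsub>M i\<^esub> (b \<odot>\<^bsub>M i\<^esub> u'), j := v)) 1
      + Poly_Mapping.single (f(i := (c \<odot>\<^bsub>M i\<^esub> u) \<oplus>\<^bsub>M i\<^esub> (d \<odot>\<^bsub>M i\<^esub> u'), j := v')) 1)
    (Poly_Mapping.single (f(i := u, j := (a \<odot>\<^bsub>M j\<^esub> v) \<oplus>\<^bsub>M j\<^esub> (c \<odot>\<^bsub>M j\<^esub> v'))) 1
      + Poly_Mapping.single (f(i := u', j := (b \<odot>\<^bsub>M j\<^esub> v) \<oplus>\<^bsub>M j\<^esub> (d \<odot>\<^bsub>M j\<^esub> v'))) 1)"
    (is "tensor_cong I M (?l1 + ?l2) (?r1 + ?r2)")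
proof -
  have upd: "f(l := w) \<in> (\<Pi>\<^sub>E i\<in>I. carrier (M i))" if "l \<in> I" "w \<in> carrier (M l)" for l w
    using PiE_fun_upd[of w "\<lambda>i. carrier (M i)" l f I] f that by (simp add: insert_absorb)
  \<comment> \<open>Both sides expand into the same four pure tensors with coefficients a, b, c, d,
    grouped by rows on the left and by columns on the right.\<close>
  let ?s = "\<lambda>x y. Poly_Mapping.single (f(i := x, j := y))"
  have "tensor_cong I M ?l1 (?s u v a + ?s u' v b)"
    using tensor_cong_single_lincomb[OF upd[OF ij(2) v(1)] ij(1) u cl[OF ij(1)]] ij
    by (simp add: fun_upd_twist)
  moreover have "tensor_cong I M ?l2 (?s u v' c + ?s u' v' d)"
    using tensor_cong_single_lincomb[OF upd[OF ij(2) v(2)] ij(1) u cl[OF ij(1)]] ij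
    by (simp add: fun_upd_twist)
  moreover have "tensor_cong I M ?r1 (?s u v a + ?s u v' c)"
    using tensor_cong_single_lincomb[OF upd[OF ij(1) u(1)] ij(2) v cl[OF ij(2)]] by simp
  moreover have "tensor_cong I M ?r2 (?s u' v b + ?s u' v' d)"
    using tensor_cong_single_lincomb[OF upd[OF ij(1) u(2)] ij(2) v cl[OF ij(2)]] by simp
  ultimately have l: "tensor_cong I M (?l1 + ?l2) ((?s u v a + ?s u' v b) + (?s u v' c + ?s u' v' d))"
      and r: "tensor_cong I M (?r1 + ?r2) ((?s u v a + ?s u v' c) + (?s u' v b + ?s u' v' d))"
    by (blast intro: tensor_cong_add)+
  have eq: "(?s u v a + ?s u v' c) + (?s u' v b + ?s u' v' d)
      = (?s u v a + ?s u' v b) + (?s u v' c + ?s u' v' d)"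
    by (simp only: ac_simps)
  show ?thesis
    by (rule tensor_cong_trans[OF l tensor_cong_sym[OF r[unfolded eq]]])
qed

text \<open>The difference of the two values is a linear combination of differences on basis
  elements, all lying in the subspace of relations. This reduces every later identity to pure
  tensors.\<close>

lemma tensor_cong_linear_extension:
  assumes "Vector_Spaces.linear free_scale free_scale T" "Vector_Spaces.linear free_scale free_scale T'"
    and "\<And>s. s \<in> S \<Longrightarrow> tensor_cong I M (T (Poly_Mapping.single s 1)) (T' (Poly_Mapping.single s 1))"
    and "x \<in> free_space S"
  shows "tensor_cong I M (T x) (T' x)"
proof -
  interpret T: Vector_Spaces.linear free_scale free_scale T by fact
  interpret T': Vector_Spaces.linear free_scale free_scale T' by fact
  have "T x - T' x = (\<Sum>s\<in>Poly_Mapping.keys x. free_scale (Poly_Mapping.lookup x s)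
      (T (Poly_Mapping.single s 1) - T' (Poly_Mapping.single s 1)))"
    by (subst (1 2) free_decomp[of x])
      (simp only: T.sum T'.sum T.scale T'.scale free.scale_right_diff_distrib sum_subtractf)
  also have "\<dots> \<in> tensor_relations I M"
    using assms(3,4) unfolding tensor_cong_def free_space_def
    by (intro free.subspace_sum free.subspace_scale subspace_tensor_relations) blast
  finally show ?thesis
    by (simp add: tensor_cong_def)
qed

section \<open>Tensor products of linear and equivariant maps\<close>

lemma intertwinersD:
  assumes "h \<in> intertwiners G V W"
  shows "x \<in> carrier V \<Longrightarrow> h x \<in> carrier W"
    and "x \<in> carrier V \<Longrightarrow> y \<in> carrier V \<Longrightarrow> h (x \<oplus>\<^bsub>V\<^esub> y) = h x \<oplus>\<^bsub>W\<^esub> h y"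
    and "x \<in> carrier V \<Longrightarrow> h (c \<odot>\<^bsub>V\<^esub> x) = c \<odot>\<^bsub>W\<^esub> h x"
    and "\<gamma> \<in> G \<Longrightarrow> x \<in> carrier V \<Longrightarrow> h (act V \<gamma> x) = act W \<gamma> (h x)"
  using assms by (auto simp: intertwiners_def)

text \<open>Over the empty set, \<open>intertwiners\<close> consists of the linear maps between the
  carriers; linearity alone is expressed in this way throughout.\<close>

lemma intertwiners_mono: "h \<in> intertwiners G V W \<Longrightarrow> H \<subseteq> G \<Longrightarrow> h \<in> intertwiners H V W"
  by (auto simp: intertwiners_def)

abbreviation family_map :: "'i set \<Rightarrow> ('i \<Rightarrow> 'v \<Rightarrow> 'w) \<Rightarrow> ('i \<Rightarrow> 'v) \<Rightarrow> 'i \<Rightarrow> 'w" where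
  "family_map I \<phi> f \<equiv> \<lambda>i\<in>I. \<phi> i (f i)"

lemma family_map_PiE:
  assumes "\<And>i. i \<in> I \<Longrightarrow> \<phi> i \<in> intertwiners G (M i) (N i)" and "f \<in> (\<Pi>\<^sub>E i\<in>I. carrier (M i))"
  shows "family_map I \<phi> f \<in> (\<Pi>\<^sub>E i\<in>I. carrier (N i))"
  using assms(2) intertwinersD(1)[OF assms(1)] by (auto simp: PiE_mem)

text \<open>This is well-definedness: linearity in each factor sends a generating relation to a
  generating relation, hence span to span.\<close>

lemma pushforward_tensor_cong:
  fixes M :: "'i \<Rightarrow> ('a::field, 'v, 'g) rep" and N :: "'i \<Rightarrow> ('a, 'w, 'g) rep"
  assumes \<phi>: "\<And>i. i \<in> I \<Longrightarrow> \<phi> i \<in> intertwiners {} (M i) (N i)" and "tensor_cong I M x y"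
  shows "tensor_cong I N (pushforward (family_map I \<phi>) x) (pushforward (family_map I \<phi>) y)"
proof -
  let ?T = "pushforward (family_map I \<phi>) :: (_ \<Rightarrow>\<^sub>0 'a) \<Rightarrow> _"
  interpret T: Vector_Spaces.linear free_scale free_scale ?T by (rule linear_pushforward)
  have upd: "family_map I \<phi> (f(i := u)) = (family_map I \<phi> f)(i := \<phi> i u)" if "i \<in> I" for f i u
    using that by (auto simp: fun_eq_iff)
  have gen: "?T r \<in> tensor_relations I N" if "r \<in>
      {Poly_Mapping.single (f(i := u \<oplus>\<^bsub>M i\<^esub> v)) 1
         - Poly_Mapping.single (f(i := u)) 1 - Poly_Mapping.single (f(i := v)) 1 | f i u v.
         f \<in> (\<Pi>\<^sub>E i\<in>I. carrier (M i)) \<and> i \<in> I \<and> u \<in> carrier (M i) \<and> v \<in> carrier (M i)}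
    \<union> {Poly_Mapping.single (f(i := c \<odot>\<^bsub>M i\<^esub> u)) 1 - Poly_Mapping.single (f(i := u)) c | f i c u.
         f \<in> (\<Pi>\<^sub>E i\<in>I. carrier (M i)) \<and> i \<in> I \<and> u \<in> carrier (M i)}" for r
    using that
  proof (elim UnE CollectE exE conjE, goal_cases)
    case (1 f i u v)
    from tensor_cong_single_add[OF family_map_PiE[OF \<phi> 1(2)], of i "\<phi> i u" "\<phi> i v" 1]
    show ?case
      using 1 intertwinersD[OF \<phi>[of i]]
      by (simp add: tensor_cong_def pushforward_diff pushforward_add upd diff_diff_eq del: fun_upd_apply)
  next
    case (2 f i c u)
    from tensor_cong_single_smult[OF family_map_PiE[OF \<phi> 2(2)], of i "\<phi> i u" c 1]
    show ?case
      using 2 intertwinersD[OF \<phi>[of i]]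
      by (simp add: tensor_cong_def pushforward_diff upd del: fun_upd_apply)
  qed
  have "?T r \<in> tensor_relations I N" if "r \<in> tensor_relations I M" for r
    using that unfolding tensor_relations_def[of I M]
  proof (induction rule: free.span_induct_alt)
    case base
    then show ?case
      by (simp add: T.zero free.subspace_0 subspace_tensor_relations)
  next
    case (step c r r')
    then show ?case
      using gen[OF step.hyps(1)]
      by (simp only: T.add T.scale)
        (intro free.subspace_add free.subspace_scale subspace_tensor_relations)
  qed
  then show ?thesis
    using assms(2) by (simp add: tensor_cong_def flip: pushforward_diff)
qed

lemma tensor_map_class:
  assumes "\<And>i. i \<in> I \<Longrightarrow> \<phi> i \<in> intertwiners {} (M i) (N i)"
  shows "tensor_map I N \<phi> (tensor_class I M x) = tensor_class I N (pushforward (family_map I \<phi>) x)"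
  unfolding tensor_map_def pushforward_def[symmetric]
  by (rule UN_tensor_class) (rule pushforward_tensor_cong[OF assms])

lemma carrier_tensor: "carrier (tensor I M) = tensor_class I M ` free_space (\<Pi>\<^sub>E i\<in>I. carrier (M i))"
  by (simp add: tensor_def)

lemma act_tensor: "act (tensor I M) \<gamma> = tensor_map I M (\<lambda>i. act (M i) \<gamma>)"
  by (simp add: tensor_def)

lemma linear_plus_pushforward:
  "Vector_Spaces.linear free_scale free_scale (\<lambda>x. pushforward h x + pushforward h' x)"
  by unfold_locales (simp_all add: pushforward_add pushforward_scale algebra_simps)

text \<open>The factorwise composite fixes every choice function with values in the carriers, and
  these are the basis elements occurring in a representative.\<close>

lemma tensor_map_comp_eq_id:
  assumes "\<And>i. i \<in> I \<Longrightarrow> \<phi> i \<in> intertwiners {} (M i) (N i)"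
    and "\<And>i. i \<in> I \<Longrightarrow> \<psi> i \<in> intertwiners {} (N i) (M i)"
    and "\<And>i x. i \<in> I \<Longrightarrow> x \<in> carrier (M i) \<Longrightarrow> \<psi> i (\<phi> i x) = x"
    and "A \<in> carrier (tensor I M)"
  shows "tensor_map I M \<psi> (tensor_map I N \<phi> A) = A"
proof -
  from assms(4) obtain x where x: "x \<in> free_space (\<Pi>\<^sub>E i\<in>I. carrier (M i))" and A: "A = tensor_class I M x"
    by (auto simp: carrier_tensor)
  have "family_map I \<psi> (family_map I \<phi> f) = f" if "f \<in> (\<Pi>\<^sub>E i\<in>I. carrier (M i))" for f
    using that assms(3) by (fastforce simp: fun_eq_iff PiE_def extensional_def)
  then have "tensor_cong I M (pushforward (\<lambda>f. family_map I \<psi> (family_map I \<phi> f)) x) (pushforward (\<lambda>f. f) x)"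
    by (intro tensor_cong_linear_extension[OF linear_pushforward linear_pushforward _ x]) simp
  moreover have "pushforward (\<lambda>f. f) x = x"
    using free_decomp[of x] by (simp add: pushforward_def)
  ultimately show ?thesis
    by (simp add: A tensor_map_class[of I \<phi> M N, OF assms(1)] tensor_map_class[of I \<psi> N M, OF assms(2)]
        pushforward_pushforward tensor_class_eq_iff)
qed

lemma tensor_map_sum_class:
  assumes "\<And>i. i \<in> I \<Longrightarrow> \<phi> i \<in> intertwiners {} (M i) (N i)"
    and "\<And>i. i \<in> I \<Longrightarrow> \<psi> i \<in> intertwiners {} (M i) (N i)"
  shows "tensor_map I N \<phi> (tensor_class I M x) \<oplus>\<^bsub>tensor I N\<^esub> tensor_map I N \<psi> (tensor_class I M x) =
    tensor_class I N (pushforward (family_map I \<phi>) x + pushforward (family_map I \<psi>) x)"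
  by (simp add: tensor_class_plus tensor_map_class[of I \<phi> M N, OF assms(1)]
      tensor_map_class[of I \<psi> M N, OF assms(2)])

text \<open>Formulated for any linear \<open>T\<close> on representatives because
  \<open>D_beta\<close> is a sum of two tensor products of maps. Equivariance is asked for only up
  to congruence, since for such a sum it uses the multilinearity relations.\<close>

lemma tensor_intertwinersI:
  fixes M :: "'i \<Rightarrow> ('a::field, 'v, 'g) rep" and N :: "'i \<Rightarrow> ('a, 'w, 'g) rep"
  assumes lin: "Vector_Spaces.linear free_scale free_scale T"
    and H: "\<And>x. x \<in> free_space (\<Pi>\<^sub>E i\<in>I. carrier (M i)) \<Longrightarrow> H (tensor_class I M x) = tensor_class I N (T x)"
    and sp: "\<And>x. x \<in> free_space (\<Pi>\<^sub>E i\<in>I. carrier (M i)) \<Longrightarrow> T x \<in> free_space (\<Pi>\<^sub>E i\<in>I. carrier (N i))"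
    and actM: "\<And>\<gamma> i. \<gamma> \<in> G \<Longrightarrow> i \<in> I \<Longrightarrow> act (M i) \<gamma> \<in> intertwiners {} (M i) (M i)"
    and actN: "\<And>\<gamma> i. \<gamma> \<in> G \<Longrightarrow> i \<in> I \<Longrightarrow> act (N i) \<gamma> \<in> intertwiners {} (N i) (N i)"
    and eqv: "\<And>\<gamma> f. \<gamma> \<in> G \<Longrightarrow> f \<in> (\<Pi>\<^sub>E i\<in>I. carrier (M i)) \<Longrightarrow> tensor_cong I N
        (T (Poly_Mapping.single (family_map I (\<lambda>i. act (M i) \<gamma>) f) 1))
        (pushforward (family_map I (\<lambda>i. act (N i) \<gamma>)) (T (Poly_Mapping.single f 1)))"
  shows "H \<in> intertwiners G (tensor I M) (tensor I N)"
proof -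
  interpret T: Vector_Spaces.linear free_scale free_scale T by fact
  let ?F = "free_space (\<Pi>\<^sub>E i\<in>I. carrier (M i)) :: (('i \<Rightarrow> 'v) \<Rightarrow>\<^sub>0 'a) set"
  have "H (A \<oplus>\<^bsub>tensor I M\<^esub> B) = H A \<oplus>\<^bsub>tensor I N\<^esub> H B"
    if "A \<in> tensor_class I M ` ?F" "B \<in> tensor_class I M ` ?F" for A B
    using that by (auto simp: tensor_class_plus H free_space_add T.add)
  moreover have "H (c \<odot>\<^bsub>tensor I M\<^esub> A) = c \<odot>\<^bsub>tensor I N\<^esub> H A" if "A \<in> tensor_class I M ` ?F" for c A
    using that by (auto simp: tensor_class_smult H free_space_scale T.scale)
  moreover have "H (act (tensor I M) \<gamma> A) = act (tensor I N) \<gamma> (H A)"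
    if "A \<in> tensor_class I M ` ?F" "\<gamma> \<in> G" for A \<gamma>
  proof -
    from that obtain x where x: "x \<in> ?F" "A = tensor_class I M x" by blast
    let ?gM = "family_map I (\<lambda>i. act (M i) \<gamma>)" and ?gN = "family_map I (\<lambda>i. act (N i) \<gamma>)"
    have gx: "pushforward ?gM x \<in> ?F"
      by (rule pushforward_free_space[OF _ x(1)]) (rule Pi_I, rule family_map_PiE[OF actM[OF that(2)]])
    have "Vector_Spaces.linear free_scale free_scale (\<lambda>x. T (pushforward ?gM x))"
      and "Vector_Spaces.linear free_scale free_scale (\<lambda>x. pushforward ?gN (T x))"
      by (unfold_locales; simp add: pushforward_add pushforward_scale T.add T.scale)+
    then have "tensor_cong I N (T (pushforward ?gM x)) (pushforward ?gN (T x))"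
      by (rule tensor_cong_linear_extension[OF _ _ _ x(1)]) (simp add: eqv[OF that(2)])
    then show ?thesis
      by (simp add: act_tensor x(2) H[OF x(1)] H[OF gx] tensor_class_eq_iff
          tensor_map_class[of I "\<lambda>i. act (M i) \<gamma>" M M, OF actM[OF that(2)]]
          tensor_map_class[of I "\<lambda>i. act (N i) \<gamma>" N N, OF actN[OF that(2)]])
  qed
  ultimately show ?thesis
    unfolding intertwiners_def carrier_tensor using H sp by auto
qed

lemma tensor_map_intertwiner:
  assumes \<phi>: "\<And>i. i \<in> I \<Longrightarrow> \<phi> i \<in> intertwiners G (M i) (N i)"
    and actM: "\<And>\<gamma> i. \<gamma> \<in> G \<Longrightarrow> i \<in> I \<Longrightarrow> act (M i) \<gamma> \<in> intertwiners {} (M i) (M i)"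
    and actN: "\<And>\<gamma> i. \<gamma> \<in> G \<Longrightarrow> i \<in> I \<Longrightarrow> act (N i) \<gamma> \<in> intertwiners {} (N i) (N i)"
  shows "tensor_map I N \<phi> \<in> intertwiners G (tensor I M) (tensor I N)"
proof (rule tensor_intertwinersI[OF linear_pushforward])
  have "\<phi> i \<in> intertwiners {} (M i) (N i)" if "i \<in> I" for i
    using \<phi>[OF that] by (rule intertwiners_mono) simp
  then show "tensor_map I N \<phi> (tensor_class I M x) = tensor_class I N (pushforward (family_map I \<phi>) x)" for x
    by (rule tensor_map_class)
  show "pushforward (family_map I \<phi>) x \<in> free_space (\<Pi>\<^sub>E i\<in>I. carrier (N i))"
    if "x \<in> free_space (\<Pi>\<^sub>E i\<in>I. carrier (M i))" for x
    by (rule pushforward_free_space[OF _ that]) (rule Pi_I, rule family_map_PiE[OF \<phi>])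
  fix \<gamma> f assume *: "\<gamma> \<in> G" "f \<in> (\<Pi>\<^sub>E i\<in>I. carrier (M i))"
  \<comment> \<open>For a single tensor product of equivariant maps, equivariance already holds on
    the choice functions themselves.\<close>
  have "family_map I \<phi> (family_map I (\<lambda>i. act (M i) \<gamma>) f) = family_map I (\<lambda>i. act (N i) \<gamma>) (family_map I \<phi> f)"
    using intertwinersD(4)[OF \<phi> *(1)] *(2) by (auto simp: fun_eq_iff PiE_mem)
  then show "tensor_cong I N
        (pushforward (family_map I \<phi>) (Poly_Mapping.single (family_map I (\<lambda>i. act (M i) \<gamma>) f) 1))
        (pushforward (family_map I (\<lambda>i. act (N i) \<gamma>))
          (pushforward (family_map I \<phi>) (Poly_Mapping.single f 1)))"
    by simp
qed (use actM actN in auto)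

text \<open>A vanishing entry is written as a multiple by 0, so that the scalar can be pulled out of
  the pure tensor.\<close>

lemma tensor_cong_single_0:
  assumes "f \<in> (\<Pi>\<^sub>E i\<in>I. carrier (M i))" and "i \<in> I" and "u \<in> carrier (M i)" and "f i = 0 \<odot>\<^bsub>M i\<^esub> u"
  shows "tensor_cong I M (Poly_Mapping.single f c) 0"
  using tensor_cong_single_smult[OF assms(1-3), of 0 c] assms(4) fun_upd_triv[of f i] by simp

section \<open>Frobenius twists and the cyclic index set\<close>

lemma funpow_power: "((\<lambda>x. x ^ p) ^^ n) x = (x :: 'a::monoid_mult) ^ (p ^ n)"
  by (induction n) (simp_all add: power_mult mult.commute flip: power_mult)

lemma twisted_homog_simps [simp]:
  "carrier (twisted_homog p k i) = carrier (homog (k i))"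
  "add (twisted_homog p k i) = (+)"
  "smult (twisted_homog p k i) = (\<lambda>c f. const2 c * f)"
  by (simp_all add: twisted_homog_def frobenius_twist_def homog_def)

lemma act_twisted_homog:
  "act (twisted_homog p k i) \<gamma> =
     linear_subst (\<gamma>$1$1 ^ p ^ i) (\<gamma>$1$2 ^ p ^ i) (\<gamma>$2$1 ^ p ^ i) (\<gamma>$2$2 ^ p ^ i)"
  by (simp add: twisted_homog_def frobenius_twist_def homog_def linear_subst_def funpow_power)

lemma twisted_homog_intertwinerI:
  assumes "\<And>f. f \<in> carrier (homog (k i)) \<Longrightarrow> h f \<in> carrier (homog (l i))"
    and "\<And>f f'. h (f + f') = h f + h f'" and "\<And>c f. h (const2 c * f) = const2 c * h f"
    and "\<And>\<gamma> f. \<gamma> \<in> G \<Longrightarrow> h (act (twisted_homog p k i) \<gamma> f) = act (twisted_homog p l i) \<gamma> (h f)"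
  shows "h \<in> intertwiners G (twisted_homog p k i) (twisted_homog p l i)"
  using assms by (auto simp: intertwiners_def)

lemma act_twisted_homog_linear:
  "act (twisted_homog p k i) \<gamma> \<in> intertwiners {} (twisted_homog p k i) (twisted_homog p k i)"
  by (rule twisted_homog_intertwinerI)
    (simp_all add: act_twisted_homog homog_linear_subst linear_subst_add linear_subst_mult)

lemma id_twisted_homog_intertwiner:
  assumes "l i = k i"
  shows "id \<in> intertwiners G (twisted_homog p k i) (twisted_homog p l i)"
  by (rule twisted_homog_intertwinerI) (simp_all add: assms act_twisted_homog)

text \<open>Advancing g - \<beta> steps from the index \<alpha> + \<beta> leads back to \<alpha>,
  possibly after one full turn of length g.\<close>

lemma mod_add_neq_shift:
  assumes "\<alpha> < g" and "1 \<le> \<beta>" and "\<beta> < (g::nat)"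
  shows "(\<alpha> + \<beta>) mod g < g" and "(\<alpha> + \<beta>) mod g \<noteq> \<alpha>"
    and "(\<alpha> + \<beta>) mod g + (g - \<beta>) = \<alpha> \<or> (\<alpha> + \<beta>) mod g + (g - \<beta>) = \<alpha> + g"
  using assms by (auto simp: mod_if le_mod_geq)

section \<open>The operator on one factor\<close>

context
  fixes p g \<alpha> :: nat and k :: "nat \<Rightarrow> nat"
  assumes p: "prime p" and card: "CARD('a::{field,finite}) = p ^ g" and \<alpha>: "\<alpha> < g"
begin

private abbreviation (input) "V \<equiv> twisted_homog p (\<lambda>i. int (k i)) :: _ \<Rightarrow> ('a, _, _) rep"

private lemma CHAR_eq: "CHAR('a) = p"
  by (rule CHAR_eq_prime[OF p card])

private lemma power_q_eq: "x ^ p ^ g = (x :: 'a)"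
  using power_card_UNIV_eq[of x] by (simp add: card)

private lemma of_nat_neq_0: "0 < n \<Longrightarrow> n \<le> p - 1 \<Longrightarrow> of_nat n \<noteq> (0 :: 'a)"
  using p by (auto simp: of_nat_eq_0_iff_char_dvd CHAR_eq dest: dvd_imp_le)

text \<open>Since a^q = a in the field, X^q and Y^q transform exactly like X and Y, and the operator
  is invariant for the same reason as X \<partial>_X + Y \<partial>_Y.\<close>

lemma D_family_intertwiner:
  "((\<lambda>i. id)(\<alpha> := \<lambda>f. varX ^ p ^ g * dX f + varY ^ p ^ g * dY f)) i
     \<in> intertwiners G (V i) (twisted_homog p (D_degrees p g (\<lambda>i. int (k i)) \<alpha>) i)"
proof (cases "i = \<alpha>")
  case True
  have X: "linear_subst a b c d (varX ^ p ^ g) = const2 a * varX ^ p ^ g + const2 c * varY ^ p ^ g"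
    and Y: "linear_subst a b c d (varY ^ p ^ g) = const2 b * varX ^ p ^ g + const2 d * varY ^ p ^ g"
    for a b c d :: 'a
    using linear_subst_varX_power[where n = g and a = a] linear_subst_varY_power[where n = g and a = a]
    by (simp_all add: CHAR_eq p power_q_eq)
  have "varX ^ p ^ g * dX f + varY ^ p ^ g * dY f \<in> carrier (homog (int (k \<alpha>) + (int (p ^ g) - 1)))"
    if "f \<in> carrier (homog (int (k \<alpha>)))" for f :: "'a poly poly"
    by (intro homog_add homog_mult[OF homog_varX_power homog_dX[OF that]]
        homog_mult[OF homog_varY_power homog_dY[OF that]]) simp_all
  then show ?thesis
    by (intro twisted_homog_intertwinerI)
      (auto simp: True D_degrees_def dX_add dY_add dX_mult dY_mult act_twisted_homog
        dX_linear_subst dY_linear_subst X Y linear_subst_add linear_subst_mult algebra_simps)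
next
  case False
  then show ?thesis
    by (simp add: id_twisted_homog_intertwiner D_degrees_def)
qed

lemma D_intertwiner:
  "D_op p g (\<lambda>i. int (k i)) \<alpha> \<in> intertwiners G
     (tensor_homog p g (\<lambda>i. int (k i)) :: ('a, _, _) rep)
     (tensor_homog p g (D_degrees p g (\<lambda>i. int (k i)) \<alpha>))"
  unfolding D_op_def tensor_homog_def
  by (intro tensor_map_intertwiner D_family_intertwiner act_twisted_homog_linear)

lemma D_inj:
  assumes "0 < k \<alpha>" and "k \<alpha> \<le> p - 1"
  shows "inj_on (D_op p g (\<lambda>i. int (k i)) \<alpha>)
     (carrier (tensor_homog p g (\<lambda>i. int (k i)) :: ('a, _, _) rep))"
proof (rule inj_on_inverseI)
  let ?N = "twisted_homog p (D_degrees p g (\<lambda>i. int (k i)) \<alpha>) :: _ \<Rightarrow> ('a, _, _) rep"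
  let ?\<phi> = "\<lambda>f::'a poly poly. varX ^ p ^ g * dX f + varY ^ p ^ g * dY f"
  let ?\<psi> = "\<lambda>f. const2 (1 / of_nat (k \<alpha>) :: 'a) * (varX * shiftX (p ^ g) f + varY * shiftY (p ^ g) f)"
  have "?\<psi> f \<in> carrier (homog (int (k \<alpha>)))"
    if "f \<in> carrier (homog (int (k \<alpha>) + (int (p ^ g) - 1)))" for f
  proof -
    \<comment> \<open>Splitting the degree this way shows that division by X^q or Y^q leaves degree
      k_\<alpha> - 1, which multiplication by a variable raises to k_\<alpha>.\<close>
    have f: "f \<in> carrier (homog (int (k \<alpha>) - 1 + int (p ^ g)))"
      using that by (simp add: algebra_simps)
    show ?thesis
      by (intro homog_smult homog_add
          homog_mult[OF homog_varX homog_shiftX[OF f]] homog_mult[OF homog_varY homog_shiftY[OF f]]) simp_all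
  qed
  then have \<psi>: "((\<lambda>i. id)(\<alpha> := ?\<psi>)) i \<in> intertwiners {} (?N i) (V i)" for i
    by (cases "i = \<alpha>")
      (auto intro!: twisted_homog_intertwinerI id_twisted_homog_intertwiner
        simp: D_degrees_def shiftX_add shiftY_add shiftX_smult shiftY_smult distrib_left mult.left_commute)
  have "?\<psi> (?\<phi> f) = f" if f: "f \<in> carrier (homog (int (k \<alpha>)))" for f
  proof -
    have "k \<alpha> < p"
      using assms by linarith
    also have "p \<le> p ^ g"
      using \<alpha> prime_gt_0_nat[OF p] by (simp add: self_le_power)
    finally have "int (k \<alpha>) < int (p ^ g)"
      by (rule of_nat_less_iff[THEN iffD2])
    then have "int (k \<alpha>) - 1 < int (p ^ g)"
      by linarith
    \<comment> \<open>The derivatives of f have degree k_\<alpha> - 1 < q, so both cross terms are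
      annihilated.\<close>
    then have "?\<psi> (?\<phi> f) = const2 (1 / of_nat (k \<alpha>)) * (varX * dX f + varY * dY f)"
      by (simp add: shiftX_add shiftY_add shiftX_varY_power_mult[OF homog_dY[OF f]]
          shiftY_varX_power_mult[OF homog_dX[OF f]])
    also have "\<dots> = f"
      using of_nat_neq_0[OF assms] by (simp add: euler_homog[OF f] flip: mult.assoc const2_mult)
    finally show ?thesis .
  qed
  then have "((\<lambda>i. id)(\<alpha> := ?\<psi>)) i (((\<lambda>i. id)(\<alpha> := ?\<phi>)) i f) = f" if "f \<in> carrier (V i)" for i f
    using that by auto
  then show "tensor_map {0..g-1} V ((\<lambda>i. id)(\<alpha> := ?\<psi>)) (D_op p g (\<lambda>i. int (k i)) \<alpha> A) = A"
    if "A \<in> carrier (tensor_homog p g (\<lambda>i. int (k i)))" for A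
    using that unfolding D_op_def tensor_homog_def
    by (intro tensor_map_comp_eq_id[OF D_family_intertwiner \<psi>])
qed

section \<open>The operator on two factors\<close>

context
  fixes \<beta> :: nat
  assumes \<beta>: "1 \<le> \<beta>" "\<beta> < g"
begin

private abbreviation (input) "\<delta> \<equiv> (\<alpha> + \<beta>) mod g"
private abbreviation (input) "Q \<equiv> p ^ (g - \<beta>)"
private abbreviation (input) "W \<equiv> twisted_homog p (D_beta_degrees p g (\<lambda>i. int (k i)) \<alpha> \<beta>) :: _ \<Rightarrow> ('a, _, _) rep"
private abbreviation (input) "I \<equiv> {0..g-1}"
private abbreviation (input) "\<phi>X \<equiv> (\<lambda>i. id)(\<alpha> := dX, \<delta> := (*) (varX ^ Q)) :: _ \<Rightarrow> 'a poly poly \<Rightarrow> _"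
private abbreviation (input) "\<phi>Y \<equiv> (\<lambda>i. id)(\<alpha> := dY, \<delta> := (*) (varY ^ Q)) :: _ \<Rightarrow> 'a poly poly \<Rightarrow> _"

private lemmas \<delta> = mod_add_neq_shift[OF \<alpha> \<beta>]

private lemma \<delta>_mem: "\<delta> \<in> I" "\<alpha> \<in> I" "\<alpha> \<noteq> \<delta>" "\<delta> \<noteq> \<alpha>"
proof -
  have "\<delta> < g"
    by (rule \<delta>(1))
  then show "\<delta> \<in> I" and "\<alpha> \<in> I"
    using \<alpha> unfolding atLeastAtMost_iff by linarith+
qed (use \<delta>(2) in auto)

private lemma \<phi>X_linear: "\<phi>X i \<in> intertwiners {} (V i) (W i)"
proof -
  have "varX ^ Q * f \<in> carrier (homog (int (k \<delta>) + int Q))" if "f \<in> carrier (homog (int (k \<delta>)))"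
    for f :: "'a poly poly"
    by (rule homog_mult[OF homog_varX_power that]) simp
  then show ?thesis
    using \<delta>_mem by (cases "i = \<alpha>"; cases "i = \<delta>")
      (auto intro!: twisted_homog_intertwinerI id_twisted_homog_intertwiner
        simp: D_beta_degrees_def homog_dX dX_add dX_mult algebra_simps)
qed

private lemma \<phi>Y_linear: "\<phi>Y i \<in> intertwiners {} (V i) (W i)"
proof -
  have "varY ^ Q * f \<in> carrier (homog (int (k \<delta>) + int Q))" if "f \<in> carrier (homog (int (k \<delta>)))"
    for f :: "'a poly poly"
    by (rule homog_mult[OF homog_varY_power that]) simp
  then show ?thesis
    using \<delta>_mem by (cases "i = \<alpha>"; cases "i = \<delta>")
      (auto intro!: twisted_homog_intertwinerI id_twisted_homog_intertwiner
        simp: D_beta_degrees_def homog_dY dY_add dY_mult algebra_simps)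
qed

lemma D_beta_class:
  "D_beta p g (\<lambda>i. int (k i)) \<alpha> \<beta> (tensor_class I V x) =
     tensor_class I W (pushforward (family_map I \<phi>X) x + pushforward (family_map I \<phi>Y) x)"
  unfolding D_beta_def Let_def by (rule tensor_map_sum_class[OF \<phi>X_linear \<phi>Y_linear])

lemma power_frobenius_shift: "(x ^ p ^ \<delta>) ^ Q = (x :: 'a) ^ p ^ \<alpha>"
proof -
  have eq: "(x ^ p ^ \<delta>) ^ Q = x ^ p ^ (\<delta> + (g - \<beta>))"
    by (simp only: power_add power_mult)
  from \<delta>(3) show ?thesis
  proof
    assume "\<delta> + (g - \<beta>) = \<alpha>"
    with eq show ?thesis by (simp only:)
  next
    \<comment> \<open>Here \<alpha> + \<beta> < g, and the Q-th power completes a full turn of g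
      Frobenius steps, which is the identity on the field.\<close>
    assume "\<delta> + (g - \<beta>) = \<alpha> + g"
    with eq have "(x ^ p ^ \<delta>) ^ Q = (x ^ p ^ \<alpha>) ^ p ^ g"
      by (simp only: power_add power_mult)
    then show ?thesis by (simp only: power_q_eq)
  qed
qed

lemma D_beta_equivariant:
  assumes f: "f \<in> (\<Pi>\<^sub>E i\<in>I. carrier (V i))"
  shows "tensor_cong I W
    (Poly_Mapping.single (family_map I \<phi>X (family_map I (\<lambda>i. act (V i) \<gamma>) f)) 1
      + Poly_Mapping.single (family_map I \<phi>Y (family_map I (\<lambda>i. act (V i) \<gamma>) f)) 1)
    (Poly_Mapping.single (family_map I (\<lambda>i. act (W i) \<gamma>) (family_map I \<phi>X f)) 1
      + Poly_Mapping.single (family_map I (\<lambda>i. act (W i) \<gamma>) (family_map I \<phi>Y f)) 1)"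
proof -
  define S where "S i = linear_subst (\<gamma>$1$1 ^ p ^ i) (\<gamma>$1$2 ^ p ^ i) (\<gamma>$2$1 ^ p ^ i) (\<gamma>$2$2 ^ p ^ i)" for i
  have act: "act (V i) \<gamma> = S i" "act (W i) \<gamma> = S i" for i
    by (simp_all add: act_twisted_homog S_def)
  have S_mult: "S i (f * h) = S i f * S i h" for i f h
    by (simp add: S_def linear_subst_mult)
  let ?a = "\<gamma>$1$1 ^ p ^ \<alpha>" and ?b = "\<gamma>$1$2 ^ p ^ \<alpha>" and ?c = "\<gamma>$2$1 ^ p ^ \<alpha>" and ?d = "\<gamma>$2$2 ^ p ^ \<alpha>"
  have SX: "S \<delta> (varX ^ Q) = const2 ?a * varX ^ Q + const2 ?c * varY ^ Q"
    and SY: "S \<delta> (varY ^ Q) = const2 ?b * varX ^ Q + const2 ?d * varY ^ Q"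
    using linear_subst_varX_power[where 'a = 'a and n = "g - \<beta>"]
      linear_subst_varY_power[where 'a = 'a and n = "g - \<beta>"]
    by (simp_all add: S_def CHAR_eq p power_frobenius_shift)
  \<comment> \<open>The four choice functions to be compared differ only in the slots \<alpha> and
    \<delta>. \<open>h\<close> supplies the common remaining entries; its own entries in these two
    slots are overwritten.\<close>
  define h where "h = family_map I S (family_map I \<phi>X f)"
  have h: "h \<in> (\<Pi>\<^sub>E i\<in>I. carrier (W i))"
    unfolding h_def act(2)[symmetric]
    by (intro family_map_PiE[OF act_twisted_homog_linear] family_map_PiE[OF \<phi>X_linear] f)
  have f\<alpha>: "f \<alpha> \<in> carrier (homog (int (k \<alpha>)))" and f\<delta>: "f \<delta> \<in> carrier (homog (int (k \<delta>)))"
    using f \<delta>_mem by (auto simp: PiE_iff)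
  have u: "S \<alpha> (dX (f \<alpha>)) \<in> carrier (W \<alpha>)" "S \<alpha> (dY (f \<alpha>)) \<in> carrier (W \<alpha>)"
    using \<delta>_mem homog_dX[OF f\<alpha>] homog_dY[OF f\<alpha>]
    by (simp_all add: D_beta_degrees_def S_def homog_linear_subst)
  have "S \<delta> (f \<delta>) \<in> carrier (homog (int (k \<delta>)))"
    by (simp add: S_def homog_linear_subst f\<delta>)
  then have v: "varX ^ Q * S \<delta> (f \<delta>) \<in> carrier (W \<delta>)" "varY ^ Q * S \<delta> (f \<delta>) \<in> carrier (W \<delta>)"
    using \<delta>_mem by (auto simp: D_beta_degrees_def intro!: homog_mult[OF homog_varX_power] homog_mult[OF homog_varY_power])
  \<comment> \<open>Acting before the operator puts rows of the twisted matrix in slot \<alpha>;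
    acting after it puts columns in slot \<delta>. This is the shape of
    \<open>tensor_cong_exchange\<close>.\<close>
  have "family_map I \<phi>X (family_map I S f) =
      h(\<alpha> := const2 ?a * S \<alpha> (dX (f \<alpha>)) + const2 ?b * S \<alpha> (dY (f \<alpha>)), \<delta> := varX ^ Q * S \<delta> (f \<delta>))"
    and "family_map I \<phi>Y (family_map I S f) =
      h(\<alpha> := const2 ?c * S \<alpha> (dX (f \<alpha>)) + const2 ?d * S \<alpha> (dY (f \<alpha>)), \<delta> := varY ^ Q * S \<delta> (f \<delta>))"
    and "family_map I S (family_map I \<phi>X f) =
      h(\<alpha> := S \<alpha> (dX (f \<alpha>)),
        \<delta> := const2 ?a * (varX ^ Q * S \<delta> (f \<delta>)) + const2 ?c * (varY ^ Q * S \<delta> (f \<delta>)))"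
    and "family_map I S (family_map I \<phi>Y f) =
      h(\<alpha> := S \<alpha> (dY (f \<alpha>)),
        \<delta> := const2 ?b * (varX ^ Q * S \<delta> (f \<delta>)) + const2 ?d * (varY ^ Q * S \<delta> (f \<delta>)))"
    using \<delta>_mem dX_linear_subst[of ?a ?b ?c ?d "f \<alpha>"] dY_linear_subst[of ?a ?b ?c ?d "f \<alpha>"]
    by (auto simp: fun_eq_iff h_def S_mult SX SY algebra_simps simp flip: S_def)
  then show ?thesis
    using tensor_cong_exchange[OF h \<delta>_mem(2,1,3) u v, of ?a ?b ?c ?d]
    by (simp add: act homog_smult)
qed

lemma D_beta_intertwiner:
  "D_beta p g (\<lambda>i. int (k i)) \<alpha> \<beta> \<in> intertwiners G
     (tensor_homog p g (\<lambda>i. int (k i)) :: ('a, _, _) rep)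
     (tensor_homog p g (D_beta_degrees p g (\<lambda>i. int (k i)) \<alpha> \<beta>))"
  unfolding tensor_homog_def
proof (rule tensor_intertwinersI[OF linear_plus_pushforward D_beta_class])
  fix x :: "(nat \<Rightarrow> 'a poly poly) \<Rightarrow>\<^sub>0 'a" assume x: "x \<in> free_space (\<Pi>\<^sub>E i\<in>I. carrier (V i))"
  have "family_map I \<phi>X \<in> (\<Pi>\<^sub>E i\<in>I. carrier (V i)) \<rightarrow> (\<Pi>\<^sub>E i\<in>I. carrier (W i))"
    and "family_map I \<phi>Y \<in> (\<Pi>\<^sub>E i\<in>I. carrier (V i)) \<rightarrow> (\<Pi>\<^sub>E i\<in>I. carrier (W i))"
    by (rule Pi_I, erule family_map_PiE[OF \<phi>X_linear])
      (rule Pi_I, erule family_map_PiE[OF \<phi>Y_linear])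
  then show "pushforward (family_map I \<phi>X) x + pushforward (family_map I \<phi>Y) x
      \<in> free_space (\<Pi>\<^sub>E i\<in>I. carrier (W i))"
    using x by (intro free_space_add pushforward_free_space)
next
  fix \<gamma> :: "'a ^ 2 ^ 2" and f assume "f \<in> (\<Pi>\<^sub>E i\<in>I. carrier (V i))"
  from D_beta_equivariant[OF this, of \<gamma>]
  show "tensor_cong I W
      (pushforward (family_map I \<phi>X) (Poly_Mapping.single (family_map I (\<lambda>i. act (V i) \<gamma>) f) 1)
        + pushforward (family_map I \<phi>Y) (Poly_Mapping.single (family_map I (\<lambda>i. act (V i) \<gamma>) f) 1))
      (pushforward (family_map I (\<lambda>i. act (W i) \<gamma>))
        (pushforward (family_map I \<phi>X) (Poly_Mapping.single f 1)
          + pushforward (family_map I \<phi>Y) (Poly_Mapping.single f 1)))"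
    by (simp only: pushforward_add pushforward_single)
qed (rule act_twisted_homog_linear)+

text \<open>The left inverse is again a sum of two tensor products of maps, so the composite has
  four terms. It equals the identity only modulo the relations, not factor by factor.\<close>

lemma D_beta_inj:
  assumes "0 < k \<alpha>" and "k \<alpha> \<le> p - 1" and "k \<delta> \<le> p - 1"
  shows "inj_on (D_beta p g (\<lambda>i. int (k i)) \<alpha> \<beta>)
     (carrier (tensor_homog p g (\<lambda>i. int (k i)) :: ('a, _, _) rep))"
proof (rule inj_on_inverseI)
  \<comment> \<open>The scalar inverting the Euler factor k_\<alpha> is placed in slot \<alpha>,
    where the Euler operator will appear.\<close>
  let ?\<psi>X = "(\<lambda>i. id)(\<alpha> := \<lambda>f. const2 (1 / of_nat (k \<alpha>)) * (varX * f), \<delta> := shiftX Q) :: _ \<Rightarrow> 'a poly poly \<Rightarrow> _"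
  let ?\<psi>Y = "(\<lambda>i. id)(\<alpha> := \<lambda>f. const2 (1 / of_nat (k \<alpha>)) * (varY * f), \<delta> := shiftY Q) :: _ \<Rightarrow> 'a poly poly \<Rightarrow> _"
  have X: "varX * f \<in> carrier (homog n)" and Y: "varY * f \<in> carrier (homog n)"
    if "f \<in> carrier (homog (n - 1))" for n and f :: "'a poly poly"
    by (rule homog_mult[OF homog_varX that] homog_mult[OF homog_varY that]; simp)+
  have \<psi>X: "?\<psi>X i \<in> intertwiners {} (W i) (V i)" for i
    using \<delta>_mem by (cases "i = \<alpha>"; cases "i = \<delta>")
      (auto intro!: twisted_homog_intertwinerI id_twisted_homog_intertwiner homog_smult X homog_shiftX
        simp: D_beta_degrees_def shiftX_add shiftX_smult distrib_left mult.left_commute)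
  have \<psi>Y: "?\<psi>Y i \<in> intertwiners {} (W i) (V i)" for i
    using \<delta>_mem by (cases "i = \<alpha>"; cases "i = \<delta>")
      (auto intro!: twisted_homog_intertwinerI id_twisted_homog_intertwiner homog_smult Y homog_shiftY
        simp: D_beta_degrees_def shiftY_add shiftY_smult distrib_left mult.left_commute)
  have "k \<delta> < p"
    using assms(3) prime_gt_0_nat[OF p] by linarith
  also have "p \<le> Q"
    using \<beta> prime_gt_0_nat[OF p] by (simp add: self_le_power)
  finally have less: "int (k \<delta>) < int Q"
    by simp
  let ?T = "\<lambda>x. pushforward (family_map I \<phi>X) x + pushforward (family_map I \<phi>Y) x"
  let ?L = "\<lambda>x. pushforward (family_map I ?\<psi>X) (?T x) + pushforward (family_map I ?\<psi>Y) (?T x)"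
  have "tensor_cong I V (?L (Poly_Mapping.single f 1)) (Poly_Mapping.single f 1)"
    if f: "f \<in> (\<Pi>\<^sub>E i\<in>I. carrier (V i))" for f
  proof -
    have f\<alpha>: "f \<alpha> \<in> carrier (homog (int (k \<alpha>)))" and f\<delta>: "f \<delta> \<in> carrier (homog (int (k \<delta>)))"
      using f \<delta>_mem by (auto simp: PiE_iff)
    let ?u = "const2 (1 / of_nat (k \<alpha>)) * (varX * dX (f \<alpha>))"
      and ?v = "const2 (1 / of_nat (k \<alpha>)) * (varY * dY (f \<alpha>))"
    have out: "f i = undefined" if "i \<notin> I" for i
      using f that by (auto simp: PiE_def extensional_def)
    have diag: "family_map I ?\<psi>X (family_map I \<phi>X f) = f(\<alpha> := ?u)"
        "family_map I ?\<psi>Y (family_map I \<phi>Y f) = f(\<alpha> := ?v)"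
      using \<delta>_mem out by (auto simp: fun_eq_iff)
    \<comment> \<open>The mixed terms vanish because their entry in slot \<delta> is 0, the degree
      there being below Q.\<close>
    have "tensor_cong I V (Poly_Mapping.single (family_map I ?\<psi>X (family_map I \<phi>Y f)) 1) 0"
    proof (rule tensor_cong_single_0)
      show "family_map I ?\<psi>X (family_map I \<phi>Y f) \<in> (\<Pi>\<^sub>E i\<in>I. carrier (V i))"
        by (intro family_map_PiE[OF \<psi>X] family_map_PiE[OF \<phi>Y_linear] f)
      show "family_map I ?\<psi>X (family_map I \<phi>Y f) \<delta> = 0 \<odot>\<^bsub>V \<delta>\<^esub> 0"
        using \<delta>_mem shiftX_varY_power_mult[OF f\<delta> less] by simp
    qed (use \<delta>_mem in simp_all)
    moreover have "tensor_cong I V (Poly_Mapping.single (family_map I ?\<psi>Y (family_map I \<phi>X f)) 1) 0"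
    proof (rule tensor_cong_single_0)
      show "family_map I ?\<psi>Y (family_map I \<phi>X f) \<in> (\<Pi>\<^sub>E i\<in>I. carrier (V i))"
        by (intro family_map_PiE[OF \<psi>Y] family_map_PiE[OF \<phi>X_linear] f)
      show "family_map I ?\<psi>Y (family_map I \<phi>X f) \<delta> = 0 \<odot>\<^bsub>V \<delta>\<^esub> 0"
        using \<delta>_mem shiftY_varX_power_mult[OF f\<delta> less] by simp
    qed (use \<delta>_mem in simp_all)
    ultimately have "tensor_cong I V (?L (Poly_Mapping.single f 1))
        ((Poly_Mapping.single (f(\<alpha> := ?u)) 1 + 0) + (0 + Poly_Mapping.single (f(\<alpha> := ?v)) 1))"
      by (simp only: pushforward_add pushforward_single diag)
        (intro tensor_cong_add tensor_cong_refl)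
    \<comment> \<open>The two surviving pure tensors agree outside slot \<alpha>, so they merge
      there into the two halves of the Euler operator.\<close>
    also have "tensor_cong I V \<dots> (Poly_Mapping.single (f(\<alpha> := ?u \<oplus>\<^bsub>V \<alpha>\<^esub> ?v)) 1)"
      using tensor_cong_sym[OF tensor_cong_single_add[OF f \<delta>_mem(2), of ?u ?v 1]]
        X[OF homog_dX[OF f\<alpha>]] Y[OF homog_dY[OF f\<alpha>]]
      by (simp add: homog_smult)
    also have "?u \<oplus>\<^bsub>V \<alpha>\<^esub> ?v = f \<alpha>"
      using of_nat_neq_0[OF assms(1,2)]
      by (simp add: euler_homog[OF f\<alpha>] flip: ring_distribs(1))
        (simp add: flip: mult.assoc const2_mult)
    finally show ?thesis
      by (simp only: fun_upd_triv)
  qed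
  moreover have "Vector_Spaces.linear free_scale free_scale ?L"
      "Vector_Spaces.linear free_scale free_scale (\<lambda>x. x)"
    by (unfold_locales; simp add: pushforward_add pushforward_scale free.scale_right_distrib)+
  ultimately have L: "tensor_cong I V (?L x) x" if "x \<in> free_space (\<Pi>\<^sub>E i\<in>I. carrier (V i))" for x
    using tensor_cong_linear_extension that by blast
  fix A assume "A \<in> carrier (tensor_homog p g (\<lambda>i. int (k i)) :: ('a, _, _) rep)"
  then obtain x where x: "x \<in> free_space (\<Pi>\<^sub>E i\<in>I. carrier (V i))" and A: "A = tensor_class I V x"
    unfolding tensor_homog_def carrier_tensor by blast
  let ?B = "D_beta p g (\<lambda>i. int (k i)) \<alpha> \<beta> A"
  show "tensor_map I V ?\<psi>X ?B \<oplus>\<^bsub>tensor I V\<^esub> tensor_map I V ?\<psi>Y ?B = A"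
    unfolding A D_beta_class tensor_map_sum_class[OF \<psi>X \<psi>Y]
    using L[OF x] by (simp only: tensor_class_eq_iff)
qed

end

end

theorem theorem3p20:
  fixes p g \<alpha> \<beta> :: nat and k :: "nat \<Rightarrow> nat"
    and D\<^sub>\<beta> D :: "((nat \<Rightarrow> 'a::{field,finite} poly poly) \<Rightarrow>\<^sub>0 'a) set
                \<Rightarrow> ((nat \<Rightarrow> 'a poly poly) \<Rightarrow>\<^sub>0 'a) set"
  assumes "prime p" and "g > 1" and "CARD('a) = p ^ g"
    and "\<alpha> \<le> g - 1" and "1 \<le> \<beta>" and "\<beta> \<le> g - 1"
    and "D\<^sub>\<beta> = D_beta p g (\<lambda>i. int (k i)) \<alpha> \<beta>"
    and "D = D_op p g (\<lambda>i. int (k i)) \<alpha>"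
  shows "D\<^sub>\<beta> \<in> intertwiners GL2
            (tensor_homog p g (\<lambda>i. int (k i)))
            (tensor_homog p g (D_beta_degrees p g (\<lambda>i. int (k i)) \<alpha> \<beta>))
       \<and> D \<in> intertwiners GL2
            (tensor_homog p g (\<lambda>i. int (k i)))
            (tensor_homog p g (D_degrees p g (\<lambda>i. int (k i)) \<alpha>))
       \<and> (0 < k \<alpha> \<and> k \<alpha> \<le> p - 1 \<longrightarrow>
            inj_on D (carrier (tensor_homog p g (\<lambda>i. int (k i)))))
       \<and> (0 < k \<alpha> \<and> k \<alpha> \<le> p - 1 \<and> k ((\<alpha> + \<beta>) mod g) \<le> p - 1 \<longrightarrow>
            inj_on D\<^sub>\<beta> (carrier (tensor_homog p g (\<lambda>i. int (k i)))))"
proof -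
  have \<alpha>: "\<alpha> < g" and \<beta>: "\<beta> < g"
    using assms by linarith+
  note ctx = \<open>prime p\<close> \<open>CARD('a) = p ^ g\<close> \<alpha>
  show ?thesis
    unfolding \<open>D\<^sub>\<beta> = _\<close> \<open>D = _\<close>
    using D_intertwiner[OF ctx] D_inj[OF ctx] D_beta_intertwiner[OF ctx \<open>1 \<le> \<beta>\<close> \<beta>]
      D_beta_inj[OF ctx \<open>1 \<le> \<beta>\<close> \<beta>]
    by blast
qed

end
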